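(* Let $\mathcal{C}$ be a prevariety of languages over a finite alphabet $A$ and let $L\subseteq A^*$ be a regular language with syntactic morphism $\alpha_L: A^*\to M_L$. The following are equivalent: (1) $L\in \mathit{SF}(\mathcal{C})$; (2) $L\in\mathit{SD}(\mathcal{C})$; (3) every $\mathcal{C}$-orbit for $\alpha_L$ is aperiodic, i.e., for every idempotent $e\in M_L$ and every element $x$ of the $\mathcal{C}$-orbit of $e$ for $\alpha_L$, we have $x^{\omega+1}=x^\omega$.
   Context: Fix a finite alphabet $A$; languages are subsets of $A^*$. A prevariety is a class of regular languages containing $\emptyset$ and $A^*$, closed under union, intersection, complement, and under the quotients $u^{-1}L=\{w\mid uw\in L\}$ and $Lu^{-1}=\{w\mid wu\in L\}$ for $u\in A^*$. $\mathit{SF}(\mathcal{C})$ is the least class containing $\mathcal{C}$ and all $\{a\}$ ($a\in A$), closed under union, complement and concatenation. A prefix code is $K\subseteq A^+$ with $K\cap KA^+=\emptyset$; it has synchronization delay $d\ge1$ if for all $u,v,w\in A^*$, $uvw\in K^+$ and $v\in K^d$ imply $uv\in K^+$; bounded synchronization delay means delay $d$ for some $d\ge1$. $KL$ is unambiguous if each word of $KL$ has a unique decomposition $uv$ with $u\in K,v\in L$. $\mathit{SD}(\mathcal{C})$ is the least class containing $\emptyset$ and all $\{a\}$ ($a\in A$), closed under intersection with languages of $\mathcal{C}$, disjoint union, unambiguous concatenation, and Kleene star of prefix codes of bounded synchronization delay. The syntactic congruence of $L$ is $u\equiv_L v$ iff $xuy\in L\Leftrightarrow xvy\in L$ for all $x,y\in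 A^*$; the syntactic monoid is $M_L=A^*/{\equiv_L}$ and $\alpha_L$ the quotient morphism. For a finite monoid $M$, $\omega$ denotes a positive integer such that $s^\omega$ is idempotent for all $s\in M$. For a class $\mathcal{C}$, a language $L_1$ is $\mathcal{C}$-separable from $L_2$ if some $K\in\mathcal{C}$ satisfies $L_1\subseteq K$ and $K\cap L_2=\emptyset$. For a morphism $\alpha:A^*\to M$ into a finite monoid, $(s,t)\in M^2$ is a $\mathcal{C}$-pair if $\alpha^{-1}(s)$ is not $\mathcal{C}$-separable from $\alpha^{-1}(t)$. For an idempotent $e\in M$, the $\mathcal{C}$-orbit of $e$ for $\alpha$ is the set $\{ese \mid s\in M,\ (e,s)\text{ is a }\mathcal{C}\text{-pair}\}$. *)

theory Defs
  imports Main
begin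

text \<open>Alphabet A = the finite type 'a; words are 'a lists; languages are 'a list sets.\<close>

definition regular :: "'a list set \<Rightarrow> bool" where
  "regular L \<longleftrightarrow> (\<exists>(\<delta>::nat \<Rightarrow> 'a \<Rightarrow> nat) q0 F n. q0 < n \<and> (\<forall>q<n. \<forall>a. \<delta> q a < n) \<and>
      L = {w. fold (\<lambda>a q. \<delta> q a) w q0 \<in> F})"

definition lquot :: "'a list \<Rightarrow> 'a list set \<Rightarrow> 'a list set" where
  "lquot u L = {w. u @ w \<in> L}"

definition rquot :: "'a list set \<Rightarrow> 'a list \<Rightarrow> 'a list set" where
  "rquot L u = {w. w @ u \<in> L}"

definition prevariety :: "'a list set set \<Rightarrow> bool" where
  "prevariety C \<longleftrightarrow> (\<forall>K\<in>C. regular K) \<and> {} \<in> C \<and> UNIV \<in> C \<and>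
     (\<forall>K\<in>C. \<forall>K'\<in>C. K \<union> K' \<in> C) \<and> (\<forall>K\<in>C. \<forall>K'\<in>C. K \<inter> K' \<in> C) \<and>
     (\<forall>K\<in>C. - K \<in> C) \<and> (\<forall>K\<in>C. \<forall>u. lquot u K \<in> C \<and> rquot K u \<in> C)"

definition conc :: "'a list set \<Rightarrow> 'a list set \<Rightarrow> 'a list set" where
  "conc K L = {u @ v | u v. u \<in> K \<and> v \<in> L}"

definition lpow :: "'a list set \<Rightarrow> nat \<Rightarrow> 'a list set" where
  "lpow K d = {concat ws | ws. length ws = d \<and> set ws \<subseteq> K}"

definition lplus :: "'a list set \<Rightarrow> 'a list set" where
  "lplus K = {concat ws | ws. ws \<noteq> [] \<and> set ws \<subseteq> K}"

definition lstar :: "'a list set \<Rightarrow> 'a list set" where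
  "lstar K = {concat ws | ws. set ws \<subseteq> K}"

definition prefix_code :: "'a list set \<Rightarrow> bool" where
  "prefix_code K \<longleftrightarrow> [] \<notin> K \<and> (\<forall>u\<in>K. \<forall>v. v \<noteq> [] \<longrightarrow> u @ v \<notin> K)"

definition sync_delay :: "'a list set \<Rightarrow> nat \<Rightarrow> bool" where
  "sync_delay K d \<longleftrightarrow> d \<ge> 1 \<and>
     (\<forall>u v w. u @ v @ w \<in> lplus K \<and> v \<in> lpow K d \<longrightarrow> u @ v \<in> lplus K)"

definition bounded_sync_delay :: "'a list set \<Rightarrow> bool" where
  "bounded_sync_delay K \<longleftrightarrow> (\<exists>d. sync_delay K d)"

definition unambiguous :: "'a list set \<Rightarrow> 'a list set \<Rightarrow> bool" where
  "unambiguous K L \<longleftrightarrow> (\<forall>w\<in>conc K L. \<exists>!p. fst p \<in> K \<and> snd p \<in> L \<and> w = fst p @ snd p)"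

inductive_set SF :: "'a list set set \<Rightarrow> 'a list set set" for C where
  SF_base: "K \<in> C \<Longrightarrow> K \<in> SF C"
| SF_letter: "{[a]} \<in> SF C"
| SF_union: "K \<in> SF C \<Longrightarrow> K' \<in> SF C \<Longrightarrow> K \<union> K' \<in> SF C"
| SF_compl: "K \<in> SF C \<Longrightarrow> - K \<in> SF C"
| SF_conc: "K \<in> SF C \<Longrightarrow> K' \<in> SF C \<Longrightarrow> conc K K' \<in> SF C"

inductive_set SD :: "'a list set set \<Rightarrow> 'a list set set" for C where
  SD_empty: "{} \<in> SD C"
| SD_letter: "{[a]} \<in> SD C"
| SD_inter: "K \<in> SD C \<Longrightarrow> L \<in> C \<Longrightarrow> K \<inter> L \<in> SD C"
| SD_disj_union: "K \<in> SD C \<Longrightarrow> K' \<in> SD C \<Longrightarrow> K \<inter> K' = {} \<Longrightarrow> K \<union> K' \<in> SD C"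
| SD_conc: "K \<in> SD C \<Longrightarrow> K' \<in> SD C \<Longrightarrow> unambiguous K K' \<Longrightarrow> conc K K' \<in> SD C"
| SD_star: "K \<in> SD C \<Longrightarrow> prefix_code K \<Longrightarrow> bounded_sync_delay K \<Longrightarrow> lstar K \<in> SD C"

definition synt_cong :: "'a list set \<Rightarrow> 'a list \<Rightarrow> 'a list \<Rightarrow> bool" where
  "synt_cong L u v \<longleftrightarrow> (\<forall>x y. x @ u @ y \<in> L \<longleftrightarrow> x @ v @ y \<in> L)"

definition synt_morph :: "'a list set \<Rightarrow> 'a list \<Rightarrow> 'a list set" where
  "synt_morph L w = {v. synt_cong L w v}"

definition synt_monoid :: "'a list set \<Rightarrow> 'a list set set" where
  "synt_monoid L = range (synt_morph L)"

definition synt_rep :: "'a list set \<Rightarrow> 'a list" where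
  "synt_rep s = (SOME u. u \<in> s)"

definition synt_mult :: "'a list set \<Rightarrow> 'a list set \<Rightarrow> 'a list set \<Rightarrow> 'a list set" where
  "synt_mult L s t = synt_morph L (synt_rep s @ synt_rep t)"

definition synt_pow :: "'a list set \<Rightarrow> 'a list set \<Rightarrow> nat \<Rightarrow> 'a list set" where
  "synt_pow L s n = synt_morph L (concat (replicate n (synt_rep s)))"

definition synt_preimage :: "'a list set \<Rightarrow> 'a list set \<Rightarrow> 'a list set" where
  "synt_preimage L s = {w. synt_morph L w = s}"

definition separable :: "'a list set set \<Rightarrow> 'a list set \<Rightarrow> 'a list set \<Rightarrow> bool" where
  "separable C L1 L2 \<longleftrightarrow> (\<exists>K\<in>C. L1 \<subseteq> K \<and> K \<inter> L2 = {})"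

definition C_pair :: "'a list set set \<Rightarrow> 'a list set \<Rightarrow> 'a list set \<Rightarrow> 'a list set \<Rightarrow> bool" where
  "C_pair C L s t \<longleftrightarrow> s \<in> synt_monoid L \<and> t \<in> synt_monoid L \<and>
     \<not> separable C (synt_preimage L s) (synt_preimage L t)"

definition C_orbit :: "'a list set set \<Rightarrow> 'a list set \<Rightarrow> 'a list set \<Rightarrow> 'a list set set" where
  "C_orbit C L e = {synt_mult L e (synt_mult L s e) | s. s \<in> synt_monoid L \<and> C_pair C L e s}"

definition is_omega :: "'a list set \<Rightarrow> nat \<Rightarrow> bool" where
  "is_omega L n \<longleftrightarrow> n > 0 \<and> (\<forall>s\<in>synt_monoid L.
     synt_mult L (synt_pow L s n) (synt_pow L s n) = synt_pow L s n)"

definition orbits_aperiodic :: "'a list set set \<Rightarrow> 'a list set \<Rightarrow> bool" where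
  "orbits_aperiodic C L \<longleftrightarrow> (\<forall>e\<in>synt_monoid L. synt_mult L e e = e \<longrightarrow>
     (\<forall>x\<in>C_orbit C L e. \<forall>\<omega>. is_omega L \<omega> \<longrightarrow> synt_pow L x (Suc \<omega>) = synt_pow L x \<omega>))"

end

theory Submission
  imports Defs
begin

text \<open>
  A finite quotient-closed \<open>F \<subseteq> C\<close> induces a finite-index congruence whose classes lie in \<open>C\<close>:
  equality of the traces \<open>{K \<in> F. w \<in> K}\<close>. Aperiodicity of all \<open>C\<close>-orbits amounts to the existence of
  such an \<open>F\<close> for which every word with idempotent trace has an aperiodic image in the syntactic monoid.
  This property survives Boolean operations and concatenation (a cut inside \<open>w\<^sup>N\<close> leaves a high power
  of \<open>w\<close> on one of its sides), so star-free languages have it.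

  Conversely, let \<open>K\<close> be a prefix code of bounded synchronization delay, partitioned into finitely
  many \<open>SD\<close> blocks, and \<open>f\<close> a finite-index congruence on \<open>K\<^sup>*\<close> that is constant on the blocks and
  aperiodic over idempotent traces. If every block is invertible, then \<open>f\<close> factors through the trace.
  Otherwise take a non-invertible block \<open>D\<close>, put \<open>B = K - D\<close>, and use \<open>K\<^sup>* = B\<^sup>* \<union> B\<^sup>* D (B\<^sup>* D)\<^sup>* B\<^sup>*\<close>: the
  code \<open>B\<close> has fewer blocks, and on \<open>(B\<^sup>* D)\<^sup>*\<close> the congruence \<open>w \<mapsto> f (c w)\<close>, \<open>c \<in> D\<close>, has a smaller image.
\<close>

subsection \<open>Words and languages\<close>

abbreviation wpow :: "'a list \<Rightarrow> nat \<Rightarrow> 'a list" where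
  "wpow w n \<equiv> concat (replicate n w)"

lemma wpow_add: "wpow w (m + n) = wpow w m @ wpow w n"
  by (simp add: replicate_add)

lemma wpow_Suc2: "wpow w (Suc n) = wpow w n @ w"
  using wpow_add[of n 1 w] by simp

lemma wpow_mult: "wpow (wpow w m) n = wpow w (m * n)"
  by (induction n) (simp_all add: wpow_add)

lemma concI: "u \<in> K \<Longrightarrow> v \<in> L \<Longrightarrow> u @ v \<in> conc K L"
  unfolding conc_def by blast

lemma concE:
  assumes "w \<in> conc K L"
  obtains u v where "u \<in> K" "v \<in> L" "w = u @ v"
  using assms unfolding conc_def by blast

lemma lstar_Nil [simp]: "[] \<in> lstar K"
  unfolding lstar_def by (auto intro: exI[of _ "[]"])

lemma lstarI: "set ws \<subseteq> K \<Longrightarrow> concat ws \<in> lstar K"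
  unfolding lstar_def by blast

lemma lstarE:
  assumes "w \<in> lstar K"
  obtains ws where "w = concat ws" "set ws \<subseteq> K"
  using assms unfolding lstar_def by blast

lemma lstar_append [intro]: "u \<in> lstar K \<Longrightarrow> v \<in> lstar K \<Longrightarrow> u @ v \<in> lstar K"
  by (elim lstarE) (metis concat_append lstarI set_append Un_least)

lemma lstar_base: "u \<in> K \<Longrightarrow> u \<in> lstar K"
  using lstarI[of "[u]" K] by simp

lemma lstar_induct [consumes 1, case_names Nil append]:
  assumes "w \<in> lstar K" and "P []"
    and "\<And>u v. u \<in> K \<Longrightarrow> v \<in> lstar K \<Longrightarrow> P v \<Longrightarrow> P (u @ v)"
  shows "P w"
proof -
  obtain ws where "w = concat ws" "set ws \<subseteq> K" using assms(1) by (rule lstarE)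
  moreover have "set ws \<subseteq> K \<Longrightarrow> P (concat ws)" for ws
    by (induction ws) (auto intro: assms(2,3) lstarI)
  ultimately show ?thesis by simp
qed

lemma lstar_cases [consumes 1, case_names Nil append]:
  assumes "w \<in> lstar K"
  obtains "w = []" | u v where "u \<in> K" "v \<in> lstar K" "w = u @ v"
  using assms by (induction rule: lstar_induct) auto

lemma lstar_snocE:
  assumes "w \<in> lstar K" "w \<noteq> []"
  obtains u v where "u \<in> lstar K" "v \<in> K" "w = u @ v"
proof -
  obtain ws where ws: "w = concat ws" "set ws \<subseteq> K" using assms(1) by (rule lstarE)
  then show ?thesis
    using assms(2) that lstarI[of "butlast ws" K] by (cases ws rule: rev_cases) auto
qed

lemma lstar_least:
  assumes "K \<subseteq> lstar K'"
  shows "lstar K \<subseteq> lstar K'"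
proof
  fix w assume "w \<in> lstar K"
  then show "w \<in> lstar K'"
    by (induction rule: lstar_induct) (use assms in auto)
qed

lemma lstar_mono: "K \<subseteq> K' \<Longrightarrow> lstar K \<subseteq> lstar K'"
  by (rule lstar_least) (auto intro: lstar_base)

lemma wpow_lstar: "w \<in> lstar K \<Longrightarrow> wpow w n \<in> lstar K"
  by (induction n) auto

lemma lplus_iff:
  assumes "[] \<notin> K"
  shows "w \<in> lplus K \<longleftrightarrow> w \<in> lstar K \<and> w \<noteq> []"
proof
  assume "w \<in> lplus K"
  then obtain ws where "w = concat ws" "ws \<noteq> []" "set ws \<subseteq> K"
    unfolding lplus_def by blast
  then show "w \<in> lstar K \<and> w \<noteq> []"
    using assms lstarI[of ws K] by (cases ws) auto
next
  assume "w \<in> lstar K \<and> w \<noteq> []"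
  then show "w \<in> lplus K"
    unfolding lplus_def lstar_def by force
qed

subsection \<open>Prefix codes\<close>

lemma prefix_code_cancel:
  assumes "prefix_code K" "u \<in> K" "v \<in> K" "u @ x = v @ y"
  shows "u = v" "x = y"
proof -
  have "u = v"
    using assms unfolding prefix_code_def append_eq_append_conv2 by (metis append_Nil2)
  then show "u = v" "x = y" using assms(4) by auto
qed

text \<open>Codewords that start at the same position coincide, so two parses read from the left
  agree until the shorter one ends.\<close>

lemma prefix_code_parse:
  assumes "prefix_code K" "set us \<subseteq> K" "set vs \<subseteq> K" "concat us @ x = concat vs"
  shows "\<exists>zs. vs = us @ zs \<and> x = concat zs"
  using assms(2-4)
proof (induction us arbitrary: vs)
  case Nil
  then show ?case by auto
next
  case (Cons u us)
  then have "u \<noteq> []" using assms(1) by (auto simp: prefix_code_def)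
  then obtain v vs' where vs: "vs = v # vs'"
    using Cons.prems(3) by (cases vs) auto
  have "u = v" "concat us @ x = concat vs'"
    using prefix_code_cancel[OF assms(1), of u v "concat us @ x" "concat vs'"] Cons.prems vs by auto
  then show ?case using Cons.IH[of vs'] Cons.prems vs by auto
qed

lemma prefix_code_lstar_cancel:
  assumes "prefix_code K" "u \<in> lstar K" "u @ v \<in> lstar K"
  shows "v \<in> lstar K"
  using assms(2,3) by (elim lstarE) (metis assms(1) prefix_code_parse lstarI set_append le_sup_iff)

lemma prefix_code_subset: "prefix_code K \<Longrightarrow> B \<subseteq> K \<Longrightarrow> prefix_code B"
  unfolding prefix_code_def by blast

text \<open>The parse of \<open>u\<close> over \<open>K\<close> is an initial segment of the parse
  of \<open>u @ v\<close> over \<open>B\<close>, so all its factors lie in \<open>B\<close>.\<close>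

lemma prefix_code_lstar_prefix:
  assumes "prefix_code K" "B \<subseteq> K" "u \<in> lstar K" "u @ v \<in> lstar B"
  shows "u \<in> lstar B"
proof -
  obtain us where us: "u = concat us" "set us \<subseteq> K" using assms(3) by (rule lstarE)
  obtain bs where bs: "u @ v = concat bs" "set bs \<subseteq> B" using assms(4) by (rule lstarE)
  obtain zs where "bs = us @ zs"
    using prefix_code_parse[OF assms(1) us(2), of bs v] us bs assms(2) by auto
  then show ?thesis using us bs by (auto intro: lstarI)
qed

text \<open>The delay of \<open>K\<close> also serves for \<open>B\<close>: it puts
  \<open>u @ v\<close> into \<open>lplus K\<close>, and \<open>prefix_code_lstar_prefix\<close>
  brings this word back to \<open>lstar B\<close>.\<close>

lemma bounded_sync_delay_subset:
  assumes "prefix_code K" "bounded_sync_delay K" "B \<subseteq> K"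
  shows "bounded_sync_delay B"
proof -
  obtain d where d: "sync_delay K d" using assms(2) unfolding bounded_sync_delay_def by blast
  have ne: "[] \<notin> K" "[] \<notin> B" using assms(1,3) unfolding prefix_code_def by auto
  have "sync_delay B d"
    unfolding sync_delay_def
  proof (intro conjI allI impI)
    show "d \<ge> 1" using d unfolding sync_delay_def by simp
    fix u v w assume h: "u @ v @ w \<in> lplus B \<and> v \<in> lpow B d"
    then have "u @ v @ w \<in> lplus K" "v \<in> lpow K d"
      using lstar_mono[OF assms(3)] assms(3) by (auto simp: lplus_iff ne lpow_def)
    then have "u @ v \<in> lplus K" using d unfolding sync_delay_def by blast
    then show "u @ v \<in> lplus B"
      using prefix_code_lstar_prefix[OF assms(1,3), of "u @ v" w] h by (auto simp: lplus_iff ne)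
  qed
  then show ?thesis unfolding bounded_sync_delay_def by blast
qed

text \<open>Every word over the code \<open>B \<union> D\<close> factors uniquely according to its occurrences of
  words of \<open>D\<close>, as an element of \<open>B\<^sup>* \<union> B\<^sup>* D (B\<^sup>* D)\<^sup>* B\<^sup>*\<close>.\<close>

locale split_code =
  fixes B D :: "'a list set"
  assumes code: "prefix_code (B \<union> D)" and disj: "B \<inter> D = {}"
begin

lemma Nil_notin: "[] \<notin> B" "[] \<notin> D"
  using code unfolding prefix_code_def by auto

lemma lstar_left: "b \<in> lstar B \<Longrightarrow> b \<in> lstar (B \<union> D)"
  using lstar_mono[of B "B \<union> D"] by blast

text \<open>Equal codewords are peeled off both sides until \<open>x\<close> meets either the empty
  word or a codeword of \<open>B\<close>; disjointness of \<open>B\<close> and \<open>D\<close>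
  excludes the latter.\<close>

lemma no_D_factor:
  assumes "b \<in> lstar B" "b' \<in> lstar B" "x \<in> D"
  shows "b \<noteq> b' @ x @ r"
  using assms(1,2)
proof (induction arbitrary: b' rule: lstar_induct)
  case Nil
  then show ?case using assms(3) Nil_notin by auto
next
  case (append u v)
  from append.prems show ?case
  proof (cases rule: lstar_cases)
    case Nil
    then show ?thesis
      using prefix_code_cancel(1)[OF code, of u x v r] append.hyps assms(3) disj by auto
  next
    case (append u' v')
    then show ?thesis
      using prefix_code_cancel[OF code, of u u' v "v' @ x @ r"] \<open>u \<in> B\<close> append.IH[of v'] by auto
  qed
qed

text \<open>The first codeword from \<open>D\<close> in a parse is determined together with its
  position. With \<open>r = r' = []\<close> this gives the unambiguity of
  \<open>conc (lstar B) D\<close>.\<close>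

lemma D_factor_unique:
  assumes "b \<in> lstar B" "b' \<in> lstar B" "x \<in> D" "x' \<in> D" "b @ x @ r = b' @ x' @ r'"
  shows "b = b' \<and> x = x' \<and> r = r'"
  using assms(1,2,5)
proof (induction arbitrary: b' rule: lstar_induct)
  case Nil
  from Nil.prems(1) show ?case
  proof (cases rule: lstar_cases)
    case Nil
    then show ?thesis
      using prefix_code_cancel[OF code, of x x' r r'] assms(3,4) \<open>[] @ x @ r = b' @ x' @ r'\<close> by auto
  next
    case (append u' v')
    then show ?thesis
      using prefix_code_cancel(1)[OF code, of x u' r "v' @ x' @ r'"] assms(3) disj Nil.prems(2)
      by auto
  qed
next
  case (append u v)
  from append.prems(1) show ?case
  proof (cases rule: lstar_cases)
    case Nil
    then show ?thesis
      using prefix_code_cancel(1)[OF code, of u x' "v @ x @ r" r'] \<open>u \<in> B\<close> assms(4) disj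
        append.prems(2) by auto
  next
    case (append u' v')
    then show ?thesis
      using prefix_code_cancel[OF code, of u u' "v @ x @ r" "v' @ x' @ r'"] \<open>u \<in> B\<close>
        append.IH[of v'] append.prems(2) by auto
  qed
qed

abbreviation "KD \<equiv> conc (lstar B) D"

text \<open>Blocks are compared one by one. A block left over on one side only would place a
  codeword of \<open>D\<close> inside a word of \<open>lstar B\<close>, against
  \<open>no_D_factor\<close>.\<close>

lemma block_star_unique:
  assumes "k \<in> lstar KD" "k' \<in> lstar KD" "b \<in> lstar B" "b' \<in> lstar B" "k @ b = k' @ b'"
  shows "k = k' \<and> b = b'"
  using assms(1,2,5)
proof (induction arbitrary: k' rule: lstar_induct)
  case Nil
  from Nil.prems(1) show ?case
  proof (cases rule: lstar_cases)
    case Nil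
    then show ?thesis using \<open>[] @ b = k' @ b'\<close> by auto
  next
    case (append u v)
    then show ?thesis
      using no_D_factor[OF assms(3), of _ _ "v @ b'"] Nil.prems(2) by (fastforce elim!: concE)
  qed
next
  case (append u v)
  then obtain p x where ux: "u = p @ x" "p \<in> lstar B" "x \<in> D" by (auto elim: concE)
  from append.prems(1) show ?case
  proof (cases rule: lstar_cases)
    case Nil
    then show ?thesis
      using no_D_factor[OF assms(4) ux(2,3), of "v @ b"] append.prems(2) ux by auto
  next
    case (append u' v')
    then obtain p' x' where ux': "u' = p' @ x'" "p' \<in> lstar B" "x' \<in> D" by (auto elim: concE)
    show ?thesis
      using D_factor_unique[OF ux(2) ux'(2) ux(3) ux'(3), of "v @ b" "v' @ b'"]
        append \<open>\<And>k'. k' \<in> lstar KD \<Longrightarrow> v @ b = k' @ b' \<Longrightarrow> v = k' \<and> b = b'\<close>[of v']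
        \<open>(u @ v) @ b = k' @ b'\<close> ux ux' by auto
  qed
qed

lemma KD_subset: "KD \<subseteq> lstar (B \<union> D)"
  by (auto elim!: concE intro!: lstar_append intro: lstar_left lstar_base)

lemma KD_star_subset: "lstar KD \<subseteq> lstar (B \<union> D)"
  by (rule lstar_least[OF KD_subset])

text \<open>The cuts are made around the first codeword from \<open>D\<close> and after the last
  one.\<close>

lemma factorization:
  assumes "w \<in> lstar (B \<union> D)"
  shows "w \<in> lstar B \<or>
    (\<exists>b x k b'. b \<in> lstar B \<and> x \<in> D \<and> k \<in> lstar KD \<and> b' \<in> lstar B \<and> w = b @ x @ k @ b')"
  using assms
proof (induction rule: lstar_induct)
  case Nil
  then show ?case by simp
next
  case (append u v)
  show ?case
  proof (cases "u \<in> B")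
    case True
    then show ?thesis using append.IH lstar_append[OF lstar_base[OF True]]
      by (metis append.assoc)
  next
    case False
    then have u: "u \<in> D" using append.hyps by auto
    from append.IH show ?thesis
    proof (elim disjE exE conjE)
      assume "v \<in> lstar B"
      then have "[] \<in> lstar B \<and> u \<in> D \<and> [] \<in> lstar KD \<and> v \<in> lstar B \<and> u @ v = [] @ u @ [] @ v"
        using u by simp
      then show ?thesis by blast
    next
      \<comment> \<open>The new codeword \<open>u\<close> becomes the first one from
        \<open>D\<close>, and the former start \<open>b @ x\<close> turns into a block of the middle
        part.\<close>
      fix b x k b' assume h: "b \<in> lstar B" "x \<in> D" "k \<in> lstar KD" "b' \<in> lstar B"
        "v = b @ x @ k @ b'"
      then have "[] \<in> lstar B \<and> u \<in> D \<and> (b @ x) @ k \<in> lstar KD \<and> b' \<in> lstar B \<and>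
          u @ v = [] @ u @ ((b @ x) @ k) @ b'"
        using u lstar_append[OF lstar_base[OF concI]] by simp
      then show ?thesis by blast
    qed
  qed
qed

lemma prefix_code_KD: "prefix_code KD"
  unfolding prefix_code_def
proof (intro conjI ballI allI impI notI)
  show "[] \<in> KD \<Longrightarrow> False" using Nil_notin by (auto elim: concE)
next
  fix u v :: "'a list" assume "u \<in> KD" "v \<noteq> []" "u @ v \<in> KD"
  then obtain p x p' x' where "p \<in> lstar B" "x \<in> D" "p' \<in> lstar B" "x' \<in> D"
      "p @ x @ v = p' @ x' @ []"
    by (auto elim!: concE)
  then have "v = []" using D_factor_unique by blast
  then show False using \<open>v \<noteq> []\<close> by simp
qed

text \<open>The \<open>lstar B\<close> tail of \<open>w\<close> merges with \<open>y\<close> into a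
  single block, since \<open>y\<close> ends with a codeword of \<open>D\<close>.\<close>

lemma append_KD:
  assumes "w \<in> lstar (B \<union> D)" "y \<in> KD"
  shows "w @ y \<in> lstar KD"
proof -
  obtain p x where y: "y = p @ x" "p \<in> lstar B" "x \<in> D" using assms(2) by (auto elim: concE)
  from factorization[OF assms(1)] show ?thesis
  proof (elim disjE exE conjE)
    assume "w \<in> lstar B"
    then have "(w @ p) @ x \<in> KD" using y by (intro concI) auto
    then show ?thesis using y lstar_base by fastforce
  next
    fix b x' k b' assume h: "b \<in> lstar B" "x' \<in> D" "k \<in> lstar KD" "b' \<in> lstar B"
      "w = b @ x' @ k @ b'"
    then have "b @ x' \<in> lstar KD" "(b' @ p) @ x \<in> lstar KD"
      using y by (auto intro!: lstar_base[of _ KD] concI lstar_append[of _ B] simp del: append_assoc)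
    then have "(b @ x') @ k @ ((b' @ p) @ x) \<in> lstar KD" using h by blast
    then show ?thesis using h y by simp
  qed
qed

text \<open>The delay grows from \<open>d\<close> to \<open>Suc d\<close>. The first
  \<open>d\<close> blocks of \<open>v\<close> hold at least \<open>d\<close> codewords of
  \<open>B \<union> D\<close>, enough for the given delay; the last block \<open>y\<close> then
  makes the prefix end in \<open>D\<close>, so that \<open>append_KD\<close> applies.\<close>

lemma bounded_sync_delay_KD:
  assumes "bounded_sync_delay (B \<union> D)"
  shows "bounded_sync_delay KD"
proof -
  obtain d where d: "sync_delay (B \<union> D) d" using assms unfolding bounded_sync_delay_def by blast
  have ne: "[] \<notin> B \<union> D" "[] \<notin> KD" using code prefix_code_KD unfolding prefix_code_def by auto
  have long: "\<exists>vs. set vs \<subseteq> B \<union> D \<and> length ws \<le> length vs \<and> concat vs = concat ws"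
    if "set ws \<subseteq> KD" for ws
    using that
  proof (induction ws)
    case Nil
    then show ?case by (intro exI[of _ "[]"]) auto
  next
    case (Cons w ws)
    then obtain vs where vs: "set vs \<subseteq> B \<union> D" "length ws \<le> length vs" "concat vs = concat ws"
      by auto
    obtain us where us: "w = concat us" "set us \<subseteq> B \<union> D"
      using Cons.prems KD_subset by (auto elim: lstarE)
    have "us \<noteq> []" using us Cons.prems ne by auto
    then have "set (us @ vs) \<subseteq> B \<union> D \<and> length (w # ws) \<le> length (us @ vs) \<and>
        concat (us @ vs) = concat (w # ws)"
      using us vs by (cases us) auto
    then show ?case by blast
  qed
  have "sync_delay KD (Suc d)"
    unfolding sync_delay_def
  proof (intro conjI allI impI)
    show "1 \<le> Suc d" by simp
    fix u v w assume h: "u @ v @ w \<in> lplus KD \<and> v \<in> lpow KD (Suc d)"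
    then obtain ws y where ws: "v = concat ws @ y" "length ws = d" "set ws \<subseteq> KD" "y \<in> KD"
      unfolding lpow_def by (auto simp: length_Suc_conv_rev)
    obtain vs where vs: "set vs \<subseteq> B \<union> D" "d \<le> length vs" "concat vs = concat ws"
      using long[OF ws(3)] ws(2) by auto
    \<comment> \<open>\<open>z\<close> collects the last \<open>d\<close> codewords of the first
      \<open>d\<close> blocks, whence \<open>v = x @ z @ y\<close>.\<close>
    define x where "x = concat (take (length vs - d) vs)"
    define z where "z = concat (drop (length vs - d) vs)"
    have xz: "concat ws = x @ z" unfolding x_def z_def vs(3)[symmetric]
      by (metis append_take_drop_id concat_append)
    have "z \<in> lpow (B \<union> D) d"
      unfolding lpow_def z_def using vs(1,2) set_drop_subset[of "length vs - d" vs] by fastforce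
    moreover have "(u @ x) @ z @ (y @ w) \<in> lplus (B \<union> D)"
      using h KD_star_subset ws(1) xz unfolding lplus_iff[OF ne(1)] lplus_iff[OF ne(2)] by auto
    ultimately have "(u @ x) @ z \<in> lplus (B \<union> D)" using d unfolding sync_delay_def by blast
    then have "((u @ x) @ z) @ y \<in> lstar KD"
      using append_KD ws(4) unfolding lplus_iff[OF ne(1)] by blast
    then have "u @ v \<in> lstar KD" using ws(1) xz by simp
    moreover have "v \<noteq> []" using ws ne by auto
    ultimately show "u @ v \<in> lplus KD" by (simp add: lplus_iff ne)
  qed
  then show ?thesis unfolding bounded_sync_delay_def by blast
qed

end

subsection \<open>Closure properties of \<open>SD\<close>\<close>

lemma unambiguousI:
  assumes "\<And>u u' v v'. u \<in> K \<Longrightarrow> u' \<in> K \<Longrightarrow> v \<in> L \<Longrightarrow> v' \<in> L \<Longrightarrow> u @ v = u' @ v' \<Longrightarrow> u = u'"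
  shows "unambiguous K L"
  unfolding unambiguous_def
proof (intro ballI)
  fix w assume "w \<in> conc K L"
  then obtain u v where uv: "u \<in> K" "v \<in> L" "w = u @ v" by (rule concE)
  show "\<exists>!p. fst p \<in> K \<and> snd p \<in> L \<and> w = fst p @ snd p"
    by (rule ex1I[of _ "(u, v)"]) (use uv assms in \<open>auto, blast+\<close>)
qed

lemma SD_Union:
  assumes "finite I" "\<And>i. i \<in> I \<Longrightarrow> X i \<in> SD C"
    and "\<And>i j. i \<in> I \<Longrightarrow> j \<in> I \<Longrightarrow> i \<noteq> j \<Longrightarrow> X i \<inter> X j = {}"
  shows "(\<Union>i\<in>I. X i) \<in> SD C"
  using assms
proof (induction I rule: finite_induct)
  case empty
  then show ?case by (simp add: SD_empty)
next
  case (insert i I)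
  have "X i \<inter> (\<Union>i\<in>I. X i) = {}" using insert.prems(2)[of i] insert.hyps by fastforce
  then have "X i \<union> (\<Union>i\<in>I. X i) \<in> SD C"
    by (intro SD_disj_union insert.IH) (use insert.prems in auto)
  then show ?case by simp
qed

subsection \<open>Finite quotient-closed families\<close>

text \<open>Compatibility is relative to \<open>S\<close> because the induction replaces
  \<open>f\<close> by \<open>w \<mapsto> f (c @ w)\<close>, whose compatibility is established on
  \<open>lstar KD\<close> only.\<close>

definition congr_on :: "'a list set \<Rightarrow> ('a list \<Rightarrow> 'b) \<Rightarrow> bool" where
  "congr_on S f \<longleftrightarrow> (\<forall>u\<in>S. \<forall>u'\<in>S. \<forall>v\<in>S. \<forall>v'\<in>S.
     f u = f u' \<longrightarrow> f v = f v' \<longrightarrow> f (u @ v) = f (u' @ v'))"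

lemma congr_onD:
  assumes "congr_on S f" "f u = f u'" "f v = f v'" "u \<in> S" "u' \<in> S" "v \<in> S" "v' \<in> S"
  shows "f (u @ v) = f (u' @ v')"
  using assms unfolding congr_on_def by blast

lemma congr_on_subset: "congr_on S f \<Longrightarrow> T \<subseteq> S \<Longrightarrow> congr_on T f"
  unfolding congr_on_def by blast

lemma idempotent_multiple:
  assumes "congr_on UNIV f" "f (wpow w n @ wpow w n) = f (wpow w n)" "k > 0"
  shows "f (wpow w (n * k)) = f (wpow w n)"
  using assms(3)
proof (induction k rule: nat_induct_non_zero)
  case 1
  then show ?case by simp
next
  case (Suc k)
  have "f (wpow w (n * Suc k)) = f (wpow w n @ wpow w (n * k))" by (simp add: wpow_add)
  also have "\<dots> = f (wpow w n @ wpow w n)" by (rule congr_onD[OF assms(1)]) (use Suc in auto)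
  finally show ?case using assms(2) by simp
qed

lemma idempotent_power:
  assumes "congr_on UNIV f" "finite (range f)"
  shows "\<exists>n>0. f (wpow w n @ wpow w n) = f (wpow w n)"
proof -
  have "finite (range (\<lambda>n. f (wpow w n)))" by (rule finite_subset[OF _ assms(2)]) auto
  then have "\<not> inj (\<lambda>n. f (wpow w n))" using finite_imageD infinite_UNIV_nat by blast
  then obtain i j where "i \<noteq> j" "f (wpow w i) = f (wpow w j)" by (auto simp: inj_def)
  then obtain i p where p: "p > 0" "f (wpow w i) = f (wpow w (i + p))"
    by (metis less_imp_add_positive linorder_neqE_nat)
  have shift: "f (wpow w (m + i + p)) = f (wpow w (m + i))" for m
    using congr_onD[OF assms(1) refl p(2)[symmetric], of "wpow w m"]
    by (simp add: wpow_add)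
  have mult: "f (wpow w (m + i + p * k)) = f (wpow w (m + i))" for m k
  proof (induction k)
    case (Suc k)
    then show ?case using shift[of "m + p * k"] by (simp add: algebra_simps)
  qed simp
  \<comment> \<open>A positive multiple of the period \<open>p\<close> that reaches the preperiod
    \<open>i\<close>; raising the exponent from \<open>n\<close> to \<open>n + n\<close> adds
    \<open>Suc i\<close> full periods.\<close>
  define n where "n = p * Suc i"
  have "i \<le> n" using p(1) unfolding n_def by (cases p) auto
  then have "f (wpow w (n + n)) = f (wpow w n)"
    using mult[of "n - i" "Suc i"] unfolding n_def[symmetric] by simp
  then show ?thesis using p(1) by (intro exI[of _ n]) (simp add: n_def wpow_add)
qed

definition frame :: "'a list set set \<Rightarrow> 'a list set set \<Rightarrow> bool" where
  "frame C F \<longleftrightarrow> finite F \<and> F \<subseteq> C \<and> (\<forall>K\<in>F. \<forall>u. lquot u K \<in> F \<and> rquot K u \<in> F)"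

definition trace :: "'a list set set \<Rightarrow> 'a list \<Rightarrow> 'a list set set" where
  "trace F w = {K \<in> F. w \<in> K}"

lemma trace_eq_iff: "trace F u = trace F v \<longleftrightarrow> (\<forall>K\<in>F. u \<in> K \<longleftrightarrow> v \<in> K)"
  unfolding trace_def by auto

text \<open>Quotient-closure allows the factors to be exchanged one at a time: \<open>v\<close> for
  \<open>v'\<close> by the left quotient at \<open>u\<close>, then \<open>u\<close> for
  \<open>u'\<close> by the right quotient at \<open>v'\<close>.\<close>

lemma congr_on_trace: "frame C F \<Longrightarrow> congr_on UNIV (trace F)"
  unfolding congr_on_def trace_eq_iff
proof (intro ballI impI)
  fix u u' v v' K assume h: "frame C F" "\<forall>K\<in>F. (u \<in> K) = (u' \<in> K)"
    "\<forall>K\<in>F. (v \<in> K) = (v' \<in> K)" "K \<in> F"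
  then have "lquot u K \<in> F" "rquot K v' \<in> F" unfolding frame_def by auto
  then have "v \<in> lquot u K \<longleftrightarrow> v' \<in> lquot u K" "u \<in> rquot K v' \<longleftrightarrow> u' \<in> rquot K v'"
    using h(2,3) by simp_all
  then show "(u @ v \<in> K) = (u' @ v' \<in> K)" unfolding lquot_def rquot_def by simp
qed

lemma finite_range_trace: "frame C F \<Longrightarrow> finite (range (trace F))"
  by (rule finite_subset[of _ "Pow F"]) (auto simp: trace_def frame_def)

text \<open>A trace class is the intersection of the members of \<open>F\<close> in the trace and
  the complements of the others, and there are finitely many traces. This is how separators in
  \<open>C\<close> and intersections with \<open>C\<close> are produced below.\<close>

lemma trace_saturated_in:
  assumes "prevariety C" "frame C F"
  shows "{w. trace F w \<in> T} \<in> C"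
proof -
  have cl: "{} \<in> C" "UNIV \<in> C" "\<And>K K'. K \<in> C \<Longrightarrow> K' \<in> C \<Longrightarrow> K \<union> K' \<in> C"
      "\<And>K K'. K \<in> C \<Longrightarrow> K' \<in> C \<Longrightarrow> K \<inter> K' \<in> C" "\<And>K. K \<in> C \<Longrightarrow> - K \<in> C"
    using assms(1) unfolding prevariety_def by auto
  have fin: "finite F" "F \<subseteq> C" using assms(2) unfolding frame_def by auto
  have inter: "(\<Inter>K\<in>G. X K) \<in> C" if "finite G" "\<And>K. K \<in> G \<Longrightarrow> X K \<in> C" for G :: "'a list set set" and X
    using that by (induction G rule: finite_induct) (auto intro: cl)
  have single: "{w. trace F w = t} \<in> C" if "t \<subseteq> F" for t
  proof -
    have "{w. trace F w = t} = (\<Inter>K\<in>F. if K \<in> t then K else - K)"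
      using that unfolding trace_def by (auto split: if_splits)
    also have "\<dots> \<in> C" by (rule inter[OF fin(1)]) (use fin(2) cl(5) in auto)
    finally show ?thesis .
  qed
  have union: "(\<Union>t\<in>S. {w. trace F w = t}) \<in> C" if "finite S" "S \<subseteq> Pow F" for S
    using that by (induction S rule: finite_induct) (auto intro: cl single)
  have "{w. trace F w \<in> T} = (\<Union>t\<in>T \<inter> Pow F. {w. trace F w = t})"
    unfolding trace_def by auto
  also have "\<dots> \<in> C" by (rule union) (use fin in auto)
  finally show ?thesis .
qed

subsection \<open>The syntactic morphism\<close>

lemma synt_morph_eq_iff: "synt_morph L u = synt_morph L v \<longleftrightarrow> synt_cong L u v"
proof
  assume "synt_morph L u = synt_morph L v"
  moreover have "v \<in> synt_morph L v" by (simp add: synt_morph_def synt_cong_def)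
  ultimately have "v \<in> synt_morph L u" by simp
  then show "synt_cong L u v" by (simp add: synt_morph_def)
qed (simp add: synt_morph_def synt_cong_def)

lemma congr_on_synt_morph: "congr_on UNIV (synt_morph L)"
  unfolding congr_on_def synt_morph_eq_iff
proof (intro ballI impI)
  fix u u' v v' assume h: "synt_cong L u u'" "synt_cong L v v'"
  have "x @ (u @ v) @ y \<in> L \<longleftrightarrow> x @ (u' @ v') @ y \<in> L" for x y
  proof -
    have "x @ u @ (v @ y) \<in> L \<longleftrightarrow> x @ u' @ (v @ y) \<in> L"
      "(x @ u') @ v @ y \<in> L \<longleftrightarrow> (x @ u') @ v' @ y \<in> L"
      using h unfolding synt_cong_def by blast+
    then show ?thesis by simp
  qed
  then show "synt_cong L (u @ v) (u' @ v')" unfolding synt_cong_def by blast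
qed

lemma synt_rep: "synt_morph L (synt_rep (synt_morph L u)) = synt_morph L u"
proof -
  have "u \<in> synt_morph L u" unfolding synt_morph_def synt_cong_def by simp
  then have "synt_rep (synt_morph L u) \<in> synt_morph L u" unfolding synt_rep_def by (rule someI)
  then have "synt_cong L u (synt_rep (synt_morph L u))" by (simp only: synt_morph_def mem_Collect_eq)
  then show ?thesis unfolding synt_morph_eq_iff[symmetric] by (rule sym)
qed

text \<open>With \<open>synt_pow_morph\<close> this removes the chosen representatives: products and
  powers in the monoid are computed on arbitrary words.\<close>

lemma synt_mult_morph: "synt_mult L (synt_morph L u) (synt_morph L v) = synt_morph L (u @ v)"
  unfolding synt_mult_def by (rule congr_onD[OF congr_on_synt_morph synt_rep synt_rep]) simp_all

lemma synt_pow_morph: "synt_pow L (synt_morph L u) n = synt_morph L (wpow u n)"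
  unfolding synt_pow_def
proof (induction n)
  case (Suc n)
  show ?case
    unfolding replicate_Suc concat.simps
    by (rule congr_onD[OF congr_on_synt_morph synt_rep Suc.IH]) simp_all
qed simp

lemma is_omega_iff:
  "is_omega L n \<longleftrightarrow>
    n > 0 \<and> (\<forall>w. synt_morph L (wpow w n @ wpow w n) = synt_morph L (wpow w n))"
  unfolding is_omega_def synt_monoid_def by (simp add: synt_pow_morph synt_mult_morph)

text \<open>Words that act alike on the states of an automaton for \<open>L\<close> are congruent.
  The action is recorded as a list of length \<open>n\<close> over \<open>{..<n}\<close>, of which
  there are finitely many.\<close>

lemma finite_synt_monoid:
  assumes "regular L"
  shows "finite (synt_monoid L)"
proof -
  obtain \<delta> :: "nat \<Rightarrow> 'a \<Rightarrow> nat" and q0 Q n where d: "q0 < n" "\<forall>q<n. \<forall>a. \<delta> q a < n"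
      "L = {w. fold (\<lambda>a q. \<delta> q a) w q0 \<in> Q}"
    using assms unfolding regular_def by blast
  define run where "run w q = fold (\<lambda>a q. \<delta> q a) w q" for w q
  have run: "q < n \<Longrightarrow> run w q < n" for w q
    unfolding run_def by (induction w arbitrary: q) (auto simp: d(2))
  define g where "g w = map (run w) [0..<n]" for w
  have "range g \<subseteq> {xs. set xs \<subseteq> {..<n} \<and> length xs = n}" using run by (auto simp: g_def)
  then have fin: "finite (range g)" by (rule finite_subset) (simp add: finite_lists_length_eq)
  have "synt_morph L u = synt_morph L v" if "g u = g v" for u v
  proof -
    have uv: "run u q = run v q" if "q < n" for q using \<open>g u = g v\<close> that by (simp add: g_def)
    have "run (x @ u @ y) q0 = run (x @ v @ y) q0" for x y
      using uv[OF run[OF d(1), of x]] by (simp add: run_def)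
    then show ?thesis unfolding synt_morph_eq_iff synt_cong_def d(3) run_def[symmetric] by simp
  qed
  then have "synt_morph L w = synt_morph L (inv g (g w))" for w
    by (metis f_inv_into_f rangeI)
  then have "synt_monoid L \<subseteq> (\<lambda>x. synt_morph L (inv g x)) ` range g"
    unfolding synt_monoid_def by blast
  then show ?thesis using fin finite_surj by blast
qed

lemma is_omega_ex:
  assumes "regular L"
  shows "\<exists>n. is_omega L n"
proof -
  have fin: "finite (synt_monoid L)" by (rule finite_synt_monoid[OF assms])
  have ex: "\<exists>n>0. synt_morph L (wpow w n @ wpow w n) = synt_morph L (wpow w n)" for w
    using idempotent_power[OF congr_on_synt_morph] fin unfolding synt_monoid_def by blast
  define k where
    "k s = (SOME n. n > 0 \<and> synt_morph L (wpow (synt_rep s) n @ wpow (synt_rep s) n)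
      = synt_morph L (wpow (synt_rep s) n))" for s
  have k: "k s > 0 \<and> synt_morph L (wpow (synt_rep s) (k s) @ wpow (synt_rep s) (k s))
      = synt_morph L (wpow (synt_rep s) (k s))" for s
    unfolding k_def using someI_ex[OF ex[of "synt_rep s"]] by blast
  \<comment> \<open>The product is a positive multiple of an idempotent exponent of every element,
    so it serves all elements at once.\<close>
  define N where "N = prod k (synt_monoid L)"
  have "N > 0" unfolding N_def using k by (simp add: prod_pos)
  moreover have "synt_morph L (wpow w N @ wpow w N) = synt_morph L (wpow w N)" for w
  proof -
    define s where "s = synt_morph L w"
    define r where "r = synt_rep s"
    have s: "s \<in> synt_monoid L" unfolding s_def synt_monoid_def by simp
    obtain m where m: "N = k s * m" unfolding N_def using fin s by (metis dvd_prodI dvdE)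
    then have "m > 0" using \<open>N > 0\<close> by (cases m) auto
    then have "synt_morph L (wpow r N) = synt_morph L (wpow r (N + N))"
      using idempotent_multiple[OF congr_on_synt_morph[of L], of "k s" r m]
        idempotent_multiple[OF congr_on_synt_morph[of L], of "k s" r "2 * m"] k[of s]
      unfolding m r_def by (simp add: mult_2 distrib_left)
    moreover have "synt_morph L (wpow r j) = synt_morph L (wpow w j)" for j
      using synt_pow_morph[of L r j] synt_pow_morph[of L w j] synt_rep[of L w]
      unfolding r_def s_def by simp
    ultimately show ?thesis by (metis wpow_add)
  qed
  ultimately show ?thesis unfolding is_omega_iff by blast
qed

text \<open>The frame consists of all two-sided quotients of \<open>K\<close>. The quotient by
  \<open>u\<close> and \<open>v\<close> depends only on their syntactic classes, and a regular
  language has finitely many of these.\<close>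

lemma frame_ex:
  assumes "prevariety C" "K \<in> C"
  shows "\<exists>F. frame C F \<and> K \<in> F"
proof -
  define F where "F = range (\<lambda>(u, v). rquot (lquot u K) v)"
  have "regular K" using assms unfolding prevariety_def by blast
  have "rquot (lquot u K) v =
      rquot (lquot (synt_rep (synt_morph K u)) K) (synt_rep (synt_morph K v))" for u v
  proof -
    have "synt_cong K u (synt_rep (synt_morph K u))" "synt_cong K v (synt_rep (synt_morph K v))"
      using synt_rep by (metis synt_morph_eq_iff)+
    then have "u @ w @ v \<in> K \<longleftrightarrow>
        synt_rep (synt_morph K u) @ w @ synt_rep (synt_morph K v) \<in> K" for w
      unfolding synt_cong_def by (metis append_Nil append_Nil2 append_assoc)
    then show ?thesis unfolding lquot_def rquot_def by auto
  qed
  then have "F \<subseteq> (\<Union>s\<in>synt_monoid K. \<Union>t\<in>synt_monoid K.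
      {rquot (lquot (synt_rep s) K) (synt_rep t)})"
    unfolding F_def synt_monoid_def by (simp add: image_subset_iff split_def) blast
  then have "finite F"
    by (rule finite_subset) (auto simp: finite_synt_monoid[OF \<open>regular K\<close>])
  moreover have "F \<subseteq> C" using assms unfolding F_def prevariety_def by auto
  moreover have "lquot x (rquot (lquot u K) v) = rquot (lquot (u @ x) K) v"
      "rquot (rquot (lquot u K) v) x = rquot (lquot u K) (x @ v)" for u v x
    unfolding lquot_def rquot_def by auto
  then have "\<forall>X\<in>F. \<forall>u. lquot u X \<in> F \<and> rquot X u \<in> F" unfolding F_def by auto
  moreover have "K = rquot (lquot [] K) []" unfolding lquot_def rquot_def by simp
  then have "K \<in> F" unfolding F_def by (metis case_prod_conv rangeI)
  ultimately show ?thesis unfolding frame_def by blast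
qed

lemma frame_Un: "frame C F \<Longrightarrow> frame C G \<Longrightarrow> frame C (F \<union> G)"
  unfolding frame_def by blast

lemma frame_family_ex:
  assumes "prevariety C" "finite S" "S \<subseteq> C"
  shows "\<exists>F. frame C F \<and> S \<subseteq> F"
  using assms(2,3)
proof (induction S rule: finite_induct)
  case empty
  then show ?case by (intro exI[of _ "{}"]) (simp add: frame_def)
next
  case (insert K S)
  then obtain F G where "frame C F" "S \<subseteq> F" "frame C G" "K \<in> G"
    using frame_ex[OF assms(1)] by (metis insert_subset)
  then show ?case using frame_Un by blast
qed

subsection \<open>From aperiodic orbits to \<open>SD\<close>\<close>

text \<open>The invariant of the induction, with \<open>F\<close> fixed throughout. Constancy of
  \<open>f\<close> on blocks allows any codeword of a block to be replaced by a fixed one; the last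
  clause is aperiodicity over idempotent traces.\<close>

definition coding ::
  "'a list set set \<Rightarrow> 'a list set set \<Rightarrow> 'a list set set \<Rightarrow> ('a list \<Rightarrow> 'b) \<Rightarrow> bool" where
  "coding C F \<K> f \<longleftrightarrow> finite \<K> \<and> \<K> \<subseteq> SD C \<and> (\<forall>X\<in>\<K>. \<forall>Y\<in>\<K>. X \<noteq> Y \<longrightarrow> X \<inter> Y = {}) \<and>
     prefix_code (\<Union>\<K>) \<and> bounded_sync_delay (\<Union>\<K>) \<and>
     congr_on (lstar (\<Union>\<K>)) f \<and> finite (f ` lstar (\<Union>\<K>)) \<and>
     (\<forall>X\<in>\<K>. \<forall>u\<in>X. \<forall>v\<in>X. f u = f v) \<and>
     (\<forall>w\<in>lstar (\<Union>\<K>). trace F (w @ w) = trace F w \<longrightarrow>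
        (\<exists>n. f (wpow w (Suc n)) = f (wpow w n)))"

lemma codingD:
  assumes "coding C F \<K> f"
  shows "finite \<K>" "\<K> \<subseteq> SD C" "\<forall>X\<in>\<K>. \<forall>Y\<in>\<K>. X \<noteq> Y \<longrightarrow> X \<inter> Y = {}"
    "prefix_code (\<Union>\<K>)" "bounded_sync_delay (\<Union>\<K>)"
    "congr_on (lstar (\<Union>\<K>)) f" "finite (f ` lstar (\<Union>\<K>))"
    "\<forall>X\<in>\<K>. \<forall>u\<in>X. \<forall>v\<in>X. f u = f v"
    "\<forall>w\<in>lstar (\<Union>\<K>). trace F (w @ w) = trace F w \<longrightarrow>
        (\<exists>n. f (wpow w (Suc n)) = f (wpow w n))"
  by (insert assms, unfold coding_def, (elim conjE, assumption)+)

lemma coding_subset: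
  assumes "coding C F \<K> f" "\<L> \<subseteq> \<K>"
  shows "coding C F \<L> f"
proof -
  note K = codingD[OF assms(1)]
  have sub: "\<Union>\<L> \<subseteq> \<Union>\<K>" using assms(2) by blast
  have st: "lstar (\<Union>\<L>) \<subseteq> lstar (\<Union>\<K>)" by (rule lstar_mono[OF sub])
  show ?thesis
    unfolding coding_def
  proof (intro conjI)
    show "finite \<L>" using K(1) assms(2) finite_subset by blast
    show "finite (f ` lstar (\<Union>\<L>))" using K(7) st by (meson finite_subset image_mono)
    show "prefix_code (\<Union>\<L>)" by (rule prefix_code_subset[OF K(4) sub])
    show "bounded_sync_delay (\<Union>\<L>)" by (rule bounded_sync_delay_subset[OF K(4,5) sub])
    show "congr_on (lstar (\<Union>\<L>)) f" by (rule congr_on_subset[OF K(6) st])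
    show "\<L> \<subseteq> SD C" using K(2) assms(2) by blast
    show "\<forall>X\<in>\<L>. \<forall>Y\<in>\<L>. X \<noteq> Y \<longrightarrow> X \<inter> Y = {}" using K(3) assms(2) by blast
    show "\<forall>X\<in>\<L>. \<forall>u\<in>X. \<forall>v\<in>X. f u = f v" using K(8) assms(2) by blast
    show "\<forall>w\<in>lstar (\<Union>\<L>). trace F (w @ w) = trace F w \<longrightarrow>
        (\<exists>n. f (wpow w (Suc n)) = f (wpow w n))" using K(9) st by blast
  qed
qed

text \<open>The image of \<open>f\<close> is a group here, and aperiodicity over the idempotent traces makes
  \<open>f\<close> factor through the trace.\<close>

lemma coding_group_SD:
  assumes "prevariety C" "frame C F" "coding C F \<K> f"
    and inv: "\<And>x. x \<in> \<Union>\<K> \<Longrightarrow> \<exists>w\<in>lstar (\<Union>\<K>). f (x @ w) = f []"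
  shows "{w \<in> lstar (\<Union>\<K>). f w = m} \<in> SD C"
proof -
  note K = codingD[OF assms(3)]
  let ?S = "lstar (\<Union>\<K>)"
  have cong: "f (u @ v) = f (u' @ v')"
    if "f u = f u'" "f v = f v'" "u \<in> ?S" "u' \<in> ?S" "v \<in> ?S" "v' \<in> ?S" for u u' v v'
    using congr_onD[OF K(6)] that by blast
  have right: "\<exists>w\<in>?S. f (u @ w) = f []" if "u \<in> ?S" for u
    using that
  proof (induction rule: lstar_induct)
    case Nil
    show ?case by (rule bexI[of _ "[]"]) auto
  next
    case (append x v)
    then obtain w' where w': "w' \<in> ?S" "f (v @ w') = f []" by blast
    obtain w where w: "w \<in> ?S" "f (x @ w) = f []" using inv append by blast
    have "f (x @ (v @ w') @ w) = f (x @ [] @ w)"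
      using append w w' lstar_base[of x "\<Union>\<K>"] by (intro cong) auto
    then show ?case using w w' by (intro bexI[of _ "w' @ w"]) auto
  qed
  \<comment> \<open>A right inverse \<open>y'\<close> of the right inverse \<open>z\<close> has the
    same value as \<open>y\<close>, so \<open>z\<close> inverts \<open>y\<close> on both
    sides.\<close>
  have both: "\<exists>z\<in>?S. f (y @ z) = f [] \<and> f (z @ y) = f []" if y: "y \<in> ?S" for y
  proof -
    obtain z where z: "z \<in> ?S" "f (y @ z) = f []" using right y by blast
    obtain y' where y': "y' \<in> ?S" "f (z @ y') = f []" using right z(1) by blast
    have "f (y @ (z @ y')) = f (y @ [])" by (rule cong) (use y y' z in auto)
    moreover have "f ((y @ z) @ y') = f ([] @ y')" by (rule cong) (use y y' z in auto)
    ultimately have yy': "f y = f y'" by simp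
    have "f (z @ y) = f (z @ y')" by (rule cong) (use y y' z yy' in auto)
    then show ?thesis using z y' by auto
  qed
  \<comment> \<open>Cancelling the \<open>n\<close>-th power in the aperiodicity equation leaves the
    unit: a group element that is aperiodic is trivial.\<close>
  have unit: "f x = f []" if x: "x \<in> ?S" "trace F (x @ x) = trace F x" for x
  proof -
    obtain n where n: "f (wpow x (Suc n)) = f (wpow x n)" using K(9) x by blast
    have xn: "wpow x n \<in> ?S" by (rule wpow_lstar[OF x(1)])
    obtain z where z: "z \<in> ?S" "f (wpow x n @ z) = f []" using right[OF xn] by blast
    have "f (wpow x (Suc n) @ z) = f (wpow x n @ z)" by (rule cong) (use n xn x z in auto)
    moreover have "f (x @ (wpow x n @ z)) = f (x @ [])" by (rule cong) (use xn x z in auto)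
    ultimately show ?thesis using z by simp
  qed
  \<comment> \<open>Choose \<open>y\<close> as a power of \<open>w\<close> such that
    \<open>y @ w\<close> has idempotent trace. Then \<open>y @ w'\<close> has the same trace, both
    words take the value of the unit, and \<open>y\<close> can be cancelled on the left.\<close>
  have tr: "f w = f w'" if w: "w \<in> ?S" "w' \<in> ?S" "trace F w = trace F w'" for w w'
  proof -
    obtain n where n: "n > 0" "trace F (wpow w n @ wpow w n) = trace F (wpow w n)"
      using idempotent_power[OF congr_on_trace[OF assms(2)] finite_range_trace[OF assms(2)]] by blast
    obtain k where k: "n = Suc k" using n(1) by (cases n) auto
    define y where "y = wpow w k"
    have y: "y \<in> ?S" unfolding y_def by (rule wpow_lstar[OF w(1)])
    have e: "wpow w n = y @ w" unfolding k y_def by (rule wpow_Suc2)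
    have t: "trace F (y @ w) = trace F (y @ w')"
      by (rule congr_onD[OF congr_on_trace[OF assms(2)] refl w(3)]) simp_all
    have t2: "trace F ((y @ w) @ (y @ w)) = trace F ((y @ w') @ (y @ w'))"
      by (rule congr_onD[OF congr_on_trace[OF assms(2)] t t]) simp_all
    have "f (y @ w) = f []" by (rule unit) (use n(2) e y w in auto)
    moreover have "f (y @ w') = f []" by (rule unit) (use n(2) e y w t t2 in auto)
    ultimately have eq: "f (y @ w) = f (y @ w')" by simp
    obtain z where z: "z \<in> ?S" "f (z @ y) = f []" using both[OF y] by blast
    have "f ((z @ y) @ w) = f ([] @ w)" by (rule cong) (use z y w in auto)
    moreover have "f ((z @ y) @ w') = f ([] @ w')" by (rule cong) (use z y w in auto)
    moreover have "f (z @ (y @ w)) = f (z @ (y @ w'))" by (rule cong) (use z y w eq in auto)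
    ultimately show ?thesis by simp
  qed
  \<comment> \<open>By \<open>tr\<close> the value is read off the trace, so the class is
    \<open>lstar (\<Union>\<K>)\<close> cut by a single language of \<open>C\<close>.\<close>
  define T where "T = trace F ` {w \<in> ?S. f w = m}"
  have "{w \<in> ?S. f w = m} = ?S \<inter> {w. trace F w \<in> T}"
    unfolding T_def using tr by (auto simp: image_iff)
  moreover have "?S \<in> SD C"
  proof (rule SD_star[OF _ K(4,5)])
    show "\<Union>\<K> \<in> SD C" using SD_Union[OF K(1), of "\<lambda>X. X" C] K(2,3) by auto
  qed
  ultimately show ?thesis using SD_inter trace_saturated_in[OF assms(1,2)] by metis
qed

text \<open>The map \<open>f'\<close> below plays the role of the local divisor of the image of \<open>f\<close> at \<open>f c\<close>;
  its image misses \<open>f []\<close>.\<close>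

lemma coding_step_SD:
  assumes "coding C F \<K> f" and "D \<in> \<K>" "c \<in> D"
    and noinv: "\<And>w. w \<in> lstar (\<Union>\<K>) \<Longrightarrow> f (c @ w) \<noteq> f []"
    and IH_B: "\<And>m. {w \<in> lstar (\<Union>(\<K> - {D})). f w = m} \<in> SD C"
    and IH_D: "\<And>\<L> f' m. coding C F \<L> (f' :: 'a list \<Rightarrow> 'b) \<Longrightarrow>
      card (f' ` lstar (\<Union>\<L>)) < card (f ` lstar (\<Union>\<K>)) \<Longrightarrow>
      {w \<in> lstar (\<Union>\<L>). f' w = m} \<in> SD C"
  shows "{w \<in> lstar (\<Union>\<K>). f w = (m :: 'b)} \<in> SD C"
proof -
  note K = codingD[OF assms(1)]
  define B where "B = \<Union>(\<K> - {D})"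
  have BD: "\<Union>\<K> = B \<union> D" using assms(2) unfolding B_def by auto
  interpret split_code B D
  proof
    show "prefix_code (B \<union> D)" using K(4) BD by simp
    show "B \<inter> D = {}" using K(3) assms(2) unfolding B_def by blast
  qed
  let ?S = "lstar (B \<union> D)"
  have cong: "f (u @ v) = f (u' @ v')"
    if "f u = f u'" "f v = f v'" "u \<in> ?S" "u' \<in> ?S" "v \<in> ?S" "v' \<in> ?S" for u u' v v'
    using congr_onD[OF K(6)] that BD by metis
  have inS: "b \<in> lstar B \<Longrightarrow> b \<in> ?S" "x \<in> D \<Longrightarrow> x \<in> ?S" "k \<in> lstar KD \<Longrightarrow> k \<in> ?S" for b x k
    using lstar_left KD_star_subset lstar_base[of x "B \<union> D"] by auto
  note [intro!] = lstar_append[of _ "B \<union> D"]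
  have fD: "x \<in> D \<Longrightarrow> f x = f c" for x using K(8) assms(2,3) by blast
  define X where "X p = {w \<in> lstar B. f w = p}" for p
  have X_SD: "X p \<in> SD C" for p unfolding X_def B_def by (rule IH_B)
  have D_SD: "D \<in> SD C" using K(2) assms(2) by blast
  have finB: "finite (f ` lstar B)"
    by (rule finite_subset[OF _ K(7)]) (use BD inS in auto)
  \<comment> \<open>The new code \<open>KD\<close> is divided according to the value of the
    \<open>lstar B\<close> part; since \<open>f\<close> is constant on \<open>D\<close>, this value
    determines \<open>f'\<close> on a block.\<close>
  define \<L> where "\<L> = (\<lambda>p. conc (X p) D) ` f ` lstar B"
  define f' where "f' w = f (c @ w)" for w
  have UL: "\<Union>\<L> = KD"
    unfolding \<L>_def X_def conc_def by blast
  have f'_cong: "f' (u @ v) = f' (u' @ v')"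
    if h: "f' u = f' u'" "f' v = f' v'" "u \<in> lstar KD" "u' \<in> lstar KD" "v \<in> lstar KD" "v' \<in> lstar KD"
    for u u' v v'
  proof -
    \<comment> \<open>A nonempty \<open>u\<close> ends with a codeword \<open>x\<close> of
      \<open>D\<close>, which may be replaced by \<open>c\<close>. Then \<open>c @ v\<close> and
      \<open>c @ v'\<close> appear as factors, and their values agree by assumption.\<close>
    have 1: "f' (u @ v) = f' (u @ v')"
    proof (cases "u = []")
      case False
      then obtain k y where ky: "u = k @ y" "k \<in> lstar KD" "y \<in> KD"
        using lstar_snocE[OF h(3)] by blast
      then obtain b x where bx: "y = b @ x" "b \<in> lstar B" "x \<in> D" by (auto elim: concE)
      define t where "t = k @ b"
      have t: "u = t @ x" "t \<in> ?S" "c @ t \<in> ?S"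
        unfolding t_def using ky bx inS assms(3) by auto
      have "f ((c @ t) @ (x @ v)) = f ((c @ t) @ (c @ v))"
           "f ((c @ t) @ (x @ v')) = f ((c @ t) @ (c @ v'))"
        using t bx(3) h(5,6) inS assms(3) fD[OF bx(3)] by (intro cong; auto)+
      moreover have "f ((c @ t) @ (c @ v)) = f ((c @ t) @ (c @ v'))"
        by (rule cong) (use t h inS assms(3) in \<open>auto simp: f'_def\<close>)
      ultimately show ?thesis unfolding f'_def t(1) by simp
    qed (use h in simp)
    have "f ((c @ u) @ v') = f ((c @ u') @ v')"
      by (rule cong) (use h inS assms(3) in \<open>auto simp: f'_def\<close>)
    then show ?thesis using 1 unfolding f'_def by simp
  qed
  have coding': "coding C F \<L> f'"
    unfolding coding_def UL
  proof (intro conjI)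
    show "finite \<L>" unfolding \<L>_def using finB by simp
    show "\<L> \<subseteq> SD C"
    proof
      fix Y assume "Y \<in> \<L>"
      then obtain p where Y: "Y = conc (X p) D" unfolding \<L>_def by blast
      have "unambiguous (X p) D"
      proof (rule unambiguousI)
        fix u u' v v' assume h: "u \<in> X p" "u' \<in> X p" "v \<in> D" "v' \<in> D" "u @ v = u' @ v'"
        then show "u = u'" using D_factor_unique[of u u' v v' "[]" "[]"] by (simp add: X_def)
      qed
      then show "Y \<in> SD C" unfolding Y by (intro SD_conc X_SD D_SD)
    qed
    show "\<forall>Y\<in>\<L>. \<forall>Z\<in>\<L>. Y \<noteq> Z \<longrightarrow> Y \<inter> Z = {}"
    proof (intro ballI impI)
      fix Y Z assume YZ: "Y \<in> \<L>" "Z \<in> \<L>" "Y \<noteq> Z"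
      obtain p where p: "Y = conc (X p) D" using YZ(1) unfolding \<L>_def by blast
      obtain q where q: "Z = conc (X q) D" using YZ(2) unfolding \<L>_def by blast
      note pq = p q
      have "p \<noteq> q" using pq \<open>Y \<noteq> Z\<close> by auto
      have False if w: "w \<in> conc (X p) D" "w \<in> conc (X q) D" for w
      proof -
        obtain b x where 1: "b \<in> X p" "x \<in> D" "w = b @ x" using w(1) by (rule concE)
        obtain b' x' where 2: "b' \<in> X q" "x' \<in> D" "w = b' @ x'" using w(2) by (rule concE)
        have "b = b'" using D_factor_unique[of b b' x x' "[]" "[]"] 1 2 by (simp add: X_def)
        then show False using 1 2 \<open>p \<noteq> q\<close> by (simp add: X_def)
      qed
      then show "Y \<inter> Z = {}" unfolding pq by blast
    qed
    show "prefix_code KD" by (rule prefix_code_KD)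
    show "bounded_sync_delay KD" using bounded_sync_delay_KD K(5) BD by simp
    show "congr_on (lstar KD) f'" unfolding congr_on_def using f'_cong by blast
    show "finite (f' ` lstar KD)"
      by (rule finite_subset[OF _ K(7)]) (use BD inS assms(3) in \<open>auto simp: f'_def\<close>)
    show "\<forall>Y\<in>\<L>. \<forall>u\<in>Y. \<forall>v\<in>Y. f' u = f' v"
    proof (intro ballI)
      fix Y u v assume "Y \<in> \<L>" "u \<in> Y" "v \<in> Y"
      then obtain p where "u \<in> conc (X p) D" "v \<in> conc (X p) D" unfolding \<L>_def by blast
      then obtain b x b' x' where h: "b \<in> X p" "x \<in> D" "u = b @ x" "b' \<in> X p" "x' \<in> D" "v = b' @ x'"
        by (elim concE) blast
      have uv: "f (b @ x) = f (b' @ x')"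
        by (rule cong) (use h inS fD[OF h(2)] fD[OF h(5)] in \<open>auto simp: X_def\<close>)
      show "f' u = f' v" unfolding f'_def h(3,6)
        by (rule cong) (use uv h inS assms(3) in \<open>auto simp: X_def\<close>)
    qed
    show "\<forall>w\<in>lstar KD. trace F (w @ w) = trace F w \<longrightarrow> (\<exists>n. f' (wpow w (Suc n)) = f' (wpow w n))"
    proof (intro ballI impI)
      fix w assume w: "w \<in> lstar KD" "trace F (w @ w) = trace F w"
      then obtain n where n: "f (wpow w (Suc n)) = f (wpow w n)" using K(9) inS BD by metis
      have "f (c @ wpow w (Suc n)) = f (c @ wpow w n)"
        by (rule cong) (use n inS(2)[OF assms(3)] wpow_lstar[OF inS(3)[OF w(1)]] in \<open>auto simp del: replicate_Suc\<close>)
      then show "\<exists>n. f' (wpow w (Suc n)) = f' (wpow w n)" unfolding f'_def by blast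
    qed
  qed
  have less: "card (f' ` lstar (\<Union>\<L>)) < card (f ` lstar (\<Union>\<K>))"
  proof (rule psubset_card_mono[OF K(7)])
    have "f' ` lstar KD \<subseteq> f ` ?S" using inS assms(3) by (auto simp: f'_def)
    moreover have "f [] \<notin> f' ` lstar KD"
    proof
      assume "f [] \<in> f' ` lstar KD"
      then obtain k where k: "f [] = f (c @ k)" "k \<in> lstar KD" unfolding f'_def by (rule imageE)
      show False using noinv[of k] inS(3)[OF k(2)] k(1) BD by simp
    qed
    moreover have "f [] \<in> f ` ?S" by simp
    ultimately have "f' ` lstar KD \<subset> f ` ?S" by blast
    then show "f' ` lstar (\<Union>\<L>) \<subset> f ` lstar (\<Union>\<K>)" unfolding UL BD .
  qed
  define Y where "Y q = {w \<in> lstar KD. f' w = q}" for q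
  have Y_SD: "Y q \<in> SD C" for q
    using IH_D[OF coding' less] unfolding Y_def UL .
  \<comment> \<open>\<open>Z\<close> fixes the values of the three variable parts of a factorization
    \<open>b @ x @ k @ b'\<close>, the middle one through \<open>f'\<close>. \<open>I\<close>
    collects the triples that some word of value \<open>m\<close> realizes.\<close>
  define Z where "Z = (\<lambda>(p, q, r). conc (X p) (conc D (conc (Y q) (X r))))"
  define I where "I = {(f b, f' k, f b') | b x k b'. b \<in> lstar B \<and> x \<in> D \<and> k \<in> lstar KD \<and>
    b' \<in> lstar B \<and> f (b @ x @ k @ b') = m}"
  have Z_elim: "\<exists>b x k b'. b \<in> X p \<and> x \<in> D \<and> k \<in> Y q \<and> b' \<in> X r \<and> w = b @ x @ k @ b'"
    if "w \<in> Z (p, q, r)" for w p q r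
    using that unfolding Z_def prod.case by (elim concE) (simp, blast)
  have Z_SD: "Z i \<in> SD C" for i
  proof -
    obtain p q r where i: "i = (p, q, r)" by (cases i)
    have 1: "unambiguous (Y q) (X r)"
    proof (rule unambiguousI)
      fix u u' v v' assume "u \<in> Y q" "u' \<in> Y q" "v \<in> X r" "v' \<in> X r" "u @ v = u' @ v'"
      then show "u = u'" using block_star_unique[of u u' v v'] by (simp add: X_def Y_def)
    qed
    have 2: "unambiguous D (conc (Y q) (X r))"
      by (rule unambiguousI, rule prefix_code_cancel(1)[OF code]) auto
    have 3: "unambiguous (X p) (conc D (conc (Y q) (X r)))"
    proof (rule unambiguousI)
      fix u u' v v' assume h: "u \<in> X p" "u' \<in> X p" "v \<in> conc D (conc (Y q) (X r))"
        "v' \<in> conc D (conc (Y q) (X r))" "u @ v = u' @ v'"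
      obtain x s where x: "x \<in> D" "v = x @ s" using h(3) by (auto elim: concE)
      obtain x' s' where x': "x' \<in> D" "v' = x' @ s'" using h(4) by (auto elim: concE)
      show "u = u'" using D_factor_unique[of u u' x x' s s'] h x x' by (simp add: X_def)
    qed
    show ?thesis unfolding i Z_def prod.case by (intro SD_conc X_SD Y_SD D_SD 1 2 3)
  qed
  have Z_disj: "Z i \<inter> Z j = {}" if "i \<noteq> j" for i j
  proof -
    obtain p q r where i: "i = (p, q, r)" by (cases i)
    obtain p' q' r' where j: "j = (p', q', r')" by (cases j)
    have "(p, q, r) = (p', q', r')" if w: "w \<in> Z (p, q, r)" "w \<in> Z (p', q', r')" for w
    proof -
      obtain b x k b1 where 1: "b \<in> X p" "x \<in> D" "k \<in> Y q" "b1 \<in> X r" "w = b @ x @ k @ b1"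
        using Z_elim[OF w(1)] by blast
      obtain b' x' k' b1' where 2: "b' \<in> X p'" "x' \<in> D" "k' \<in> Y q'" "b1' \<in> X r'"
          "w = b' @ x' @ k' @ b1'"
        using Z_elim[OF w(2)] by blast
      have e: "b = b' \<and> x = x' \<and> k @ b1 = k' @ b1'"
        by (rule D_factor_unique) (use 1 2 in \<open>auto simp: X_def\<close>)
      have "k = k' \<and> b1 = b1'"
        by (rule block_star_unique) (use 1 2 e in \<open>auto simp: X_def Y_def\<close>)
      then show ?thesis using 1 2 e by (auto simp: X_def Y_def)
    qed
    then show ?thesis using that unfolding i j by blast
  qed
  have "finite I"
  proof (rule finite_subset)
    show "I \<subseteq> f ` ?S \<times> f ` ?S \<times> f ` ?S" using inS assms(3) by (auto simp: I_def f'_def)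
    show "finite (f ` ?S \<times> f ` ?S \<times> f ` ?S)" using K(7) BD by simp
  qed
  have "{w \<in> ?S. f w = m} = X m \<union> (\<Union>i\<in>I. Z i)"
  proof (intro equalityI subsetI)
    fix w assume w: "w \<in> {w \<in> ?S. f w = m}"
    then have "w \<in> ?S" by simp
    from factorization[OF this] show "w \<in> X m \<union> (\<Union>i\<in>I. Z i)"
    proof (elim disjE exE conjE)
      assume "w \<in> lstar B"
      then show ?thesis using w by (simp add: X_def)
    next
      fix b x k b' assume h: "b \<in> lstar B" "x \<in> D" "k \<in> lstar KD" "b' \<in> lstar B" "w = b @ x @ k @ b'"
      then have "(f b, f' k, f b') \<in> I" using w unfolding I_def by blast
      moreover have "w \<in> Z (f b, f' k, f b')"
        unfolding Z_def prod.case h(5) using h by (intro concI) (auto simp: X_def Y_def)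
      ultimately show ?thesis by blast
    qed
  next
    fix w assume "w \<in> X m \<union> (\<Union>i\<in>I. Z i)"
    then consider "w \<in> X m" | i where "i \<in> I" "w \<in> Z i" by blast
    then show "w \<in> {w \<in> ?S. f w = m}"
    proof cases
      case 1
      then show ?thesis using inS by (simp add: X_def)
    next
      case 2
      then obtain b x k b1 where h: "b \<in> lstar B" "x \<in> D" "k \<in> lstar KD" "b1 \<in> lstar B"
          "f (b @ x @ k @ b1) = m" "i = (f b, f' k, f b1)"
        unfolding I_def by blast
      obtain b' x' k' b1' where g: "b' \<in> X (f b)" "x' \<in> D" "k' \<in> Y (f' k)" "b1' \<in> X (f b1)"
          "w = b' @ x' @ k' @ b1'"
        using Z_elim[OF 2(2)[unfolded h(6)]] by blast
      have S: "b' \<in> ?S" "k' \<in> ?S" "b1' \<in> ?S" "x' \<in> ?S" "b \<in> ?S" "k \<in> ?S" "b1 \<in> ?S" "x \<in> ?S" "c \<in> ?S"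
        using g h inS assms(3) by (auto simp: X_def Y_def)
      \<comment> \<open>Exchanging a codeword of \<open>D\<close> for \<open>c\<close> leaves the
        value unchanged, so \<open>f' k\<close> determines \<open>f (x @ k)\<close> for every
        \<open>x\<close> in \<open>D\<close>.\<close>
      have "f (x' @ k') = f (c @ k')" "f (x @ k) = f (c @ k)"
        using S fD[OF h(2)] fD[OF g(2)] by (intro cong; auto)+
      then have 1: "f (x' @ k') = f (x @ k)" using g(3) by (simp add: Y_def f'_def)
      have 2: "f ((x' @ k') @ b1') = f ((x @ k) @ b1)"
        by (rule cong) (use 1 S g(4) in \<open>auto simp: X_def\<close>)
      have "f (b' @ ((x' @ k') @ b1')) = f (b @ ((x @ k) @ b1))"
        by (rule cong) (use 2 S g(1) in \<open>auto simp: X_def\<close>)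
      then show ?thesis using h(5) g(5) S by auto
    qed
  qed
  moreover have "(\<Union>i\<in>I. Z i) \<in> SD C" by (rule SD_Union[OF \<open>finite I\<close> Z_SD Z_disj])
  moreover have "X m \<inter> (\<Union>i\<in>I. Z i) = {}"
  proof -
    have False if "w \<in> X m" "w \<in> Z i" for w i
    proof -
      obtain p q r where i: "i = (p, q, r)" by (cases i)
      show False
        using Z_elim[OF that(2)[unfolded i]] that(1) no_D_factor[of w] by (auto simp: X_def)
    qed
    then show ?thesis by blast
  qed
  ultimately show ?thesis unfolding BD using SD_disj_union X_SD by metis
qed

text \<open>Lexicographic induction on the size of the image, then the number of blocks. Deleting
  \<open>D\<close> never enlarges the image and lowers the number of blocks; passing to
  \<open>KD\<close> may create more blocks but shrinks the image.\<close>

lemma coding_SD: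
  fixes f :: "'a list \<Rightarrow> 'b"
  assumes "prevariety C" "frame C F" "coding C F \<K> f"
  shows "{w \<in> lstar (\<Union>\<K>). f w = m} \<in> SD C"
  using assms(3)
proof (induction "(\<K>, f)" arbitrary: \<K> f m
    rule: wf_induct_rule[OF wf_inv_image[OF wf_lex_prod[OF wf_less_than wf_less_than],
      of "\<lambda>(\<K>, f). (card (f ` lstar (\<Union>\<K>)), card \<K>)"]])
  case (1 \<K> f)
  note K = codingD[OF 1(2)]
  show ?case
  proof (cases "\<forall>x\<in>\<Union>\<K>. \<exists>w\<in>lstar (\<Union>\<K>). f (x @ w) = f []")
    case True
    then show ?thesis using coding_group_SD[OF assms(1,2) 1(2)] by blast
  next
    case False
    then obtain D c where D: "D \<in> \<K>" "c \<in> D" "\<And>w. w \<in> lstar (\<Union>\<K>) \<Longrightarrow> f (c @ w) \<noteq> f []"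
      by blast
    show ?thesis
    proof (rule coding_step_SD[OF 1(2) D])
      have "card (f ` lstar (\<Union>(\<K> - {D}))) \<le> card (f ` lstar (\<Union>\<K>))"
        by (intro card_mono[OF K(7)] image_mono lstar_mono) auto
      moreover have "card (\<K> - {D}) < card \<K>" by (rule card_Diff1_less[OF K(1) D(1)])
      ultimately show "{w \<in> lstar (\<Union>(\<K> - {D})). f w = m} \<in> SD C" for m
        using 1(1)[of "\<K> - {D}" f m] coding_subset[OF 1(2), of "\<K> - {D}"] by (auto simp: le_less)
    next
      fix \<L> and f' :: "'a list \<Rightarrow> 'b" and m
      assume "coding C F \<L> f'" "card (f' ` lstar (\<Union>\<L>)) < card (f ` lstar (\<Union>\<K>))"
      then show "{w \<in> lstar (\<Union>\<L>). f' w = m} \<in> SD C" using 1(1)[of \<L> f' m] by auto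
    qed
  qed
qed

section \<open>Application to the alphabet viewed as a code\<close>

lemma lstar_letters: "lstar (range (\<lambda>a. [a])) = UNIV"
proof -
  have "w \<in> lstar (range (\<lambda>a. [a]))" for w :: "'a list"
  proof (induction w)
    case (Cons a w)
    then show ?case using lstar_append[OF lstar_base[of "[a]"]] by fastforce
  qed simp
  then show ?thesis by blast
qed

text \<open>The frame contains one separator for every separable pair of syntactic classes, so words
  of equal trace have images that form a \<open>C\<close>-pair. Then \<open>coding_SD\<close>
  applies to the syntactic morphism, with one block per letter.\<close>

lemma orbits_aperiodic_SD:
  fixes C :: "('a::finite) list set set"
  assumes "prevariety C" "regular L" "orbits_aperiodic C L"
  shows "L \<in> SD C"
proof -
  let ?\<alpha> = "synt_morph L"
  have finM: "finite (synt_monoid L)" by (rule finite_synt_monoid[OF assms(2)])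
  define sep where "sep = (\<lambda>(s, t). SOME K. K \<in> C \<and> synt_preimage L s \<subseteq> K \<and> K \<inter> synt_preimage L t = {})"
  define P where "P = {(s, t) \<in> synt_monoid L \<times> synt_monoid L.
    separable C (synt_preimage L s) (synt_preimage L t)}"
  have sep: "sep (s, t) \<in> C \<and> synt_preimage L s \<subseteq> sep (s, t) \<and> sep (s, t) \<inter> synt_preimage L t = {}"
    if st: "(s, t) \<in> P" for s t
  proof -
    have "\<exists>K. K \<in> C \<and> synt_preimage L s \<subseteq> K \<and> K \<inter> synt_preimage L t = {}"
      using st unfolding P_def separable_def by blast
    from someI_ex[OF this] show ?thesis unfolding sep_def by simp
  qed
  have "finite P" by (rule finite_subset[of _ "synt_monoid L \<times> synt_monoid L"])
      (use finM in \<open>auto simp: P_def\<close>)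
  moreover have "sep ` P \<subseteq> C" using sep by auto
  ultimately obtain F where F: "frame C F" "sep ` P \<subseteq> F"
    using frame_family_ex[OF assms(1), of "sep ` P"] by auto
  obtain \<omega> where om: "is_omega L \<omega>" using is_omega_ex[OF assms(2)] by blast
  then have "\<omega> > 0" and idem: "?\<alpha> (wpow w \<omega> @ wpow w \<omega>) = ?\<alpha> (wpow w \<omega>)" for w
    by (auto simp: is_omega_iff)
  \<comment> \<open>With idempotent trace, \<open>w\<close> and its \<omega>-th power have equal
    traces, so their images form a \<open>C\<close>-pair and the power
    \<open>2 * \<omega> + 1\<close> of \<open>w\<close> lies over the orbit of
    \<open>e\<close>.\<close>
  have aper: "\<exists>n. ?\<alpha> (wpow w (Suc n)) = ?\<alpha> (wpow w n)" if w: "trace F (w @ w) = trace F w" for w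
  proof -
    have tr: "trace F (wpow w \<omega>) = trace F w"
      using idempotent_multiple[OF congr_on_trace[OF F(1)], of 1 w \<omega>] w \<open>\<omega> > 0\<close> by simp
    define e where "e = ?\<alpha> (wpow w \<omega>)"
    have mem: "e \<in> synt_monoid L" "?\<alpha> w \<in> synt_monoid L" unfolding e_def synt_monoid_def by auto
    have ee: "synt_mult L e e = e" unfolding e_def synt_mult_morph by (rule idem)
    have "C_pair C L e (?\<alpha> w)"
    proof (rule ccontr)
      assume "\<not> ?thesis"
      then have p: "(e, ?\<alpha> w) \<in> P" using mem unfolding C_pair_def P_def by blast
      define K where "K = sep (e, ?\<alpha> w)"
      have "K \<in> F" using F(2) p unfolding K_def by blast
      moreover have "wpow w \<omega> \<in> K" "w \<notin> K"
        using sep[OF p] unfolding K_def synt_preimage_def e_def by auto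
      ultimately show False using tr unfolding trace_eq_iff by blast
    qed
    then have "synt_mult L e (synt_mult L (?\<alpha> w) e) \<in> C_orbit C L e"
      using mem unfolding C_orbit_def by blast
    moreover define v where "v = wpow w (\<omega> + (1 + \<omega>))"
    have "synt_mult L e (synt_mult L (?\<alpha> w) e) = ?\<alpha> v"
      unfolding e_def synt_mult_morph v_def wpow_add by simp
    ultimately have "synt_pow L (?\<alpha> v) (Suc \<omega>) = synt_pow L (?\<alpha> v) \<omega>"
      using assms(3) mem(1) ee om unfolding orbits_aperiodic_def by metis
    then have v: "?\<alpha> (wpow v (Suc \<omega>)) = ?\<alpha> (wpow v \<omega>)" unfolding synt_pow_morph .
    \<comment> \<open>Orbit aperiodicity compares the exponents
      \<open>(2 * \<omega> + 1) * \<omega>\<close> and \<open>(2 * \<omega> + 1) * (\<omega> + 1) =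
      \<omega> * (2 * \<omega> + 3) + 1\<close>. Positive multiples of \<omega> give equal images,
      so \<open>a\<close> and \<open>Suc a\<close> do too.\<close>
    define a where "a = \<omega> * (\<omega> + (1 + \<omega>))"
    have "(\<omega> + (1 + \<omega>)) * Suc \<omega> = \<omega> * (2 * \<omega> + 3) + 1" by (simp add: algebra_simps)
    then have "wpow v (Suc \<omega>) = wpow w (\<omega> * (2 * \<omega> + 3) + 1)"
      unfolding v_def wpow_mult by (simp only:)
    moreover have "wpow v \<omega> = wpow w a"
      unfolding v_def wpow_mult a_def by (simp only: mult.commute)
    ultimately have "?\<alpha> (wpow w a) = ?\<alpha> (wpow w (\<omega> * (2 * \<omega> + 3)) @ w)"
      using v unfolding wpow_add by simp
    also have "\<dots> = ?\<alpha> (wpow w a @ w)"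
    proof (rule congr_onD[OF congr_on_synt_morph _ refl])
      show "?\<alpha> (wpow w (\<omega> * (2 * \<omega> + 3))) = ?\<alpha> (wpow w a)"
        unfolding a_def
        using idempotent_multiple[OF congr_on_synt_morph[of L] idem, of "2 * \<omega> + 3" w]
          idempotent_multiple[OF congr_on_synt_morph[of L] idem, of "\<omega> + (1 + \<omega>)" w] by simp
    qed simp_all
    also have "\<dots> = ?\<alpha> (wpow w (Suc a))" by (simp only: wpow_Suc2)
    finally show ?thesis by metis
  qed
  define \<K> :: "'a list set set" where "\<K> = range (\<lambda>a. {[a]})"
  have U: "\<Union>\<K> = range (\<lambda>a. [a])" unfolding \<K>_def by auto
  have ne: "[] \<notin> range (\<lambda>a::'a. [a])" by auto
  \<comment> \<open>Every nonempty word is a product of letters, so delay 1 is immediate.\<close>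
  have "sync_delay (range (\<lambda>a::'a. [a])) 1"
    unfolding sync_delay_def lplus_iff[OF ne] lstar_letters lpow_def
    by (auto simp: length_Suc_conv)
  then have "coding C F \<K> ?\<alpha>"
    unfolding coding_def U lstar_letters using aper finM
    by (auto simp: \<K>_def prefix_code_def bounded_sync_delay_def synt_monoid_def congr_on_synt_morph
        intro: SD_letter)
  then have cls: "{w. ?\<alpha> w = m} \<in> SD C" for m
    using coding_SD[OF assms(1) F(1), of \<K> ?\<alpha> m] unfolding U lstar_letters by simp
  have "v \<in> L" if "u \<in> L" "?\<alpha> v = ?\<alpha> u" for u v
  proof -
    have "[] @ v @ [] \<in> L \<longleftrightarrow> [] @ u @ [] \<in> L"
      using that(2) unfolding synt_morph_eq_iff synt_cong_def by blast
    then show ?thesis using that(1) by simp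
  qed
  then have "L = (\<Union>m\<in>?\<alpha> ` L. {w. ?\<alpha> w = m})" by auto
  moreover have "\<dots> \<in> SD C"
  proof (rule SD_Union)
    show "finite (?\<alpha> ` L)" by (rule finite_subset[OF _ finM]) (auto simp: synt_monoid_def)
  qed (auto intro: cls)
  ultimately show ?thesis by simp
qed

subsection \<open>\<open>SD\<close> languages are star-free over \<open>C\<close>\<close>

lemma SF_inter: "K \<in> SF C \<Longrightarrow> K' \<in> SF C \<Longrightarrow> K \<inter> K' \<in> SF C"
  using SF_compl[OF SF_union[OF SF_compl SF_compl], of K C K'] by simp

lemma SF_empty: "prevariety C \<Longrightarrow> {} \<in> SF C"
  by (rule SF_base) (simp add: prevariety_def)

lemma SF_UNIV: "prevariety C \<Longrightarrow> UNIV \<in> SF C"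
  by (rule SF_base) (simp add: prevariety_def)

lemma SF_Union:
  assumes "prevariety C" "finite I" "\<And>i. i \<in> I \<Longrightarrow> X i \<in> SF C"
  shows "(\<Union>i\<in>I. X i) \<in> SF C"
  using assms(2,3)
  by (induction I rule: finite_induct) (auto intro: SF_union SF_empty[OF assms(1)])

text \<open>The nonempty words are a finite union over the first letter.\<close>

lemma SF_Nil:
  fixes C :: "('a::finite) list set set"
  assumes "prevariety C"
  shows "{[]} \<in> SF C"
proof -
  have "w \<in> {[]} \<longleftrightarrow> w \<in> - (\<Union>a. conc {[a]} UNIV)" for w :: "'a list"
    by (cases w) (auto simp: conc_def)
  then have "{[]} = - (\<Union>a::'a. conc {[a]} UNIV)" by blast
  also have "\<dots> \<in> SF C"
    by (intro SF_compl SF_Union[OF assms] SF_conc SF_letter SF_UNIV[OF assms]) auto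
  finally show ?thesis .
qed

lemma lpow_0: "lpow K 0 = {[]}"
  unfolding lpow_def by auto

lemma lpow_Suc: "lpow K (Suc n) = conc K (lpow K n)"
proof (intro equalityI subsetI)
  fix w assume "w \<in> lpow K (Suc n)"
  then obtain u us where "w = u @ concat us" "u \<in> K" "length us = n" "set us \<subseteq> K"
    unfolding lpow_def by (auto simp: length_Suc_conv)
  then show "w \<in> conc K (lpow K n)" unfolding conc_def lpow_def by blast
next
  fix w assume "w \<in> conc K (lpow K n)"
  then obtain u us where "w = concat (u # us)" "length (u # us) = Suc n" "set (u # us) \<subseteq> K"
    unfolding conc_def lpow_def by auto
  then show "w \<in> lpow K (Suc n)" unfolding lpow_def by blast
qed

lemma SF_lpow:
  fixes C :: "('a::finite) list set set"
  assumes "prevariety C" "K \<in> SF C"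
  shows "lpow K n \<in> SF C"
  by (induction n) (simp_all add: lpow_0 lpow_Suc SF_Nil SF_conc assms)

lemma lpow_lstar: "w \<in> lpow K n \<Longrightarrow> w \<in> lstar K"
  unfolding lpow_def lstar_def by blast

text \<open>The complement of \<open>K\<^sup>*\<close> consists of the words whose greedy parse over \<open>K\<close> gets stuck;
  bounded delay lets one forget all but the last \<open>d\<close> factors of that parse.\<close>

lemma compl_lstar:
  assumes "prefix_code K" "sync_delay K d"
  defines "R \<equiv> - (conc K UNIV \<union> {[]})"
  shows "- lstar K = (\<Union>i<d. conc (lpow K i) R) \<union> conc UNIV (conc (lpow K d) R)"
proof (intro equalityI subsetI)
  fix w assume w: "w \<in> - lstar K"
  \<comment> \<open>Codewords are stripped from the left as long as one is a prefix; the remainder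
    is empty or stuck, that is, in \<open>R\<close>.\<close>
  have "\<exists>ws r. set ws \<subseteq> K \<and> r \<in> R \<union> {[]} \<and> w = concat ws @ r" for w
  proof (induction w rule: length_induct)
    case (1 w)
    show ?case
    proof (cases "w \<in> R \<union> {[]}")
      case True
      then show ?thesis by (intro exI[of _ "[]"] exI[of _ w]) auto
    next
      case False
      then obtain u v where u: "u \<in> K" "w = u @ v" unfolding R_def conc_def by auto
      then have "u \<noteq> []" using assms(1) unfolding prefix_code_def by blast
      then have "length v < length w" using u(2) by simp
      then obtain ws r where "set ws \<subseteq> K" "r \<in> R \<union> {[]}" "v = concat ws @ r"
        using 1 by blast
      then show ?thesis using u by (intro exI[of _ "u # ws"] exI[of _ r]) auto
    qed
  qed
  then obtain ws r where ws: "set ws \<subseteq> K" "r \<in> R \<union> {[]}" "w = concat ws @ r" by blast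
  have "r \<noteq> []" using w ws(3) lstarI[OF ws(1)] by auto
  then have r: "r \<in> R" using ws by simp
  show "w \<in> (\<Union>i<d. conc (lpow K i) R) \<union> conc UNIV (conc (lpow K d) R)"
  proof (cases "length ws < d")
    case True
    have "concat ws \<in> lpow K (length ws)" unfolding lpow_def using ws by blast
    then have "w \<in> conc (lpow K (length ws)) R" unfolding ws(3) using r by (rule concI)
    then show ?thesis using True by blast
  next
    case False
    let ?n = "length ws - d"
    have "concat (drop ?n ws) \<in> lpow K d"
      unfolding lpow_def using False ws(1) set_drop_subset[of ?n ws] by fastforce
    then have "concat (take ?n ws) @ (concat (drop ?n ws) @ r) \<in> conc UNIV (conc (lpow K d) R)"
      using r by (intro concI) auto
    moreover have "concat (take ?n ws) @ (concat (drop ?n ws) @ r) = w"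
      unfolding ws(3) by (metis append_assoc append_take_drop_id concat_append)
    ultimately show ?thesis by simp
  qed
next
  fix w assume w: "w \<in> (\<Union>i<d. conc (lpow K i) R) \<union> conc UNIV (conc (lpow K d) R)"
  have ne: "[] \<notin> K" using assms(1) unfolding prefix_code_def by blast
  have R: "r \<notin> lstar K" if "r \<in> R" for r
  proof
    assume "r \<in> lstar K"
    then show False using that unfolding R_def conc_def by (cases rule: lstar_cases) auto
  qed
  have stuck: "u @ r \<notin> lstar K" if "u \<in> lstar K" "r \<in> R" for u r
    using prefix_code_lstar_cancel[OF assms(1) that(1)] R[OF that(2)] by blast
  from w show "w \<in> - lstar K"
  proof
    assume "w \<in> (\<Union>i<d. conc (lpow K i) R)"
    then obtain i where "w \<in> conc (lpow K i) R" by blast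
    then obtain u r where "u \<in> lpow K i" "r \<in> R" "w = u @ r" by (rule concE)
    then show ?thesis using stuck[OF lpow_lstar] by simp
  next
    assume "w \<in> conc UNIV (conc (lpow K d) R)"
    then obtain u v r where uv: "v \<in> lpow K d" "r \<in> R" "w = u @ v @ r" by (auto elim!: concE)
    show ?thesis
    proof
      assume "w \<in> lstar K"
      moreover have "r \<noteq> []" using uv(2) unfolding R_def by auto
      ultimately have "u @ v @ r \<in> lplus K" using uv(3) unfolding lplus_iff[OF ne] by simp
      \<comment> \<open>The delay forces a parse boundary right before the stuck word
        \<open>r\<close>, so \<open>stuck\<close> rules out a parse of the whole word.\<close>
      then have "u @ v \<in> lplus K" using assms(2) uv(1) unfolding sync_delay_def by blast
      then have "u @ v \<in> lstar K" unfolding lplus_iff[OF ne] by simp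
      then show False using stuck[of "u @ v" r] uv \<open>w \<in> lstar K\<close> by simp
    qed
  qed
qed

lemma SD_subset_SF:
  fixes C :: "('a::finite) list set set"
  assumes "prevariety C" "L \<in> SD C"
  shows "L \<in> SF C"
  using assms(2)
proof (induction rule: SD.induct)
  case (SD_star K)
  obtain d where d: "sync_delay K d" using SD_star unfolding bounded_sync_delay_def by blast
  have "- (- lstar K) \<in> SF C"
    unfolding compl_lstar[OF \<open>prefix_code K\<close> d]
    by (intro SF_compl SF_union SF_conc SF_Union[OF assms(1)] SF_lpow[OF assms(1)]
        SF_UNIV[OF assms(1)] SF_Nil[OF assms(1)] SD_star.IH) auto
  then show ?case by simp
qed (auto intro: SF.intros SF_inter SF_empty[OF assms(1)])

subsection \<open>Star-free languages have aperiodic orbits\<close>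

text \<open>The threshold \<open>n\<close> is uniform in \<open>w\<close> and in the contexts, which
  lets the thresholds of two languages be combined under concatenation.\<close>

definition stable :: "'a list set set \<Rightarrow> nat \<Rightarrow> 'a list set \<Rightarrow> bool" where
  "stable F n L \<longleftrightarrow> (\<forall>w i j. trace F (w @ w) = trace F w \<longrightarrow> i \<ge> n \<longrightarrow> j \<ge> n \<longrightarrow>
     synt_cong L (wpow w i) (wpow w j))"

lemma stable_mono: "stable F n L \<Longrightarrow> F \<subseteq> G \<Longrightarrow> n \<le> m \<Longrightarrow> stable G m L"
  unfolding stable_def trace_eq_iff by (meson le_trans subsetD)

lemma wpow_cut:
  assumes "wpow w (Suc n) = s @ t"
  shows "\<exists>i j p q. i + j = n \<and> w = p @ q \<and> s = wpow w i @ p \<and> t = q @ wpow w j"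
  using assms
proof (induction n arbitrary: s)
  case 0
  then show ?case by (intro exI[of _ 0] exI[of _ s] exI[of _ t]) auto
next
  case (Suc n)
  then have "w @ wpow w (Suc n) = s @ t" by simp
  then consider s' where "s = w @ s'" "wpow w (Suc n) = s' @ t" | q where "w = s @ q" "t = q @ wpow w (Suc n)"
    unfolding append_eq_append_conv2 by auto
  then show ?case
  proof cases
    case 1
    then obtain i j p q where "i + j = n" "w = p @ q" "s' = wpow w i @ p" "t = q @ wpow w j"
      using Suc.IH[of s'] by blast
    then have "Suc i + j = Suc n \<and> w = p @ q \<and> s = wpow w (Suc i) @ p \<and> t = q @ wpow w j"
      using 1 by simp
    then show ?thesis by blast
  next
    case 2
    then have "0 + Suc n = Suc n \<and> w = s @ q \<and> s = wpow w 0 @ s \<and> t = q @ wpow w (Suc n)" by simp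
    then show ?thesis by blast
  qed
qed

text \<open>A cut inside the power splits one copy of \<open>w\<close> and leaves \<open>M\<close>
  whole copies, hence at least \<open>n\<close> on one side; that side absorbs the change from
  \<open>M\<close> to \<open>M'\<close>. The successor counts the split copy. A cut inside
  \<open>x\<close> or \<open>y\<close> leaves the power whole.\<close>

lemma conc_wpow:
  assumes K: "\<And>i j x y. i \<ge> n \<Longrightarrow> j \<ge> n \<Longrightarrow> x @ wpow w i @ y \<in> K \<Longrightarrow> x @ wpow w j @ y \<in> K"
    and K': "\<And>i j x y. i \<ge> n \<Longrightarrow> j \<ge> n \<Longrightarrow> x @ wpow w i @ y \<in> K' \<Longrightarrow> x @ wpow w j @ y \<in> K'"
    and ge: "M \<ge> 2 * n" "M' \<ge> 2 * n"
    and mem: "x @ wpow w (Suc M) @ y \<in> conc K K'"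
  shows "x @ wpow w (Suc M') @ y \<in> conc K K'"
proof -
  obtain u v where uv: "u \<in> K" "v \<in> K'" "x @ (wpow w (Suc M) @ y) = u @ v"
    using mem by (rule concE)
  then consider x' where "x = u @ x'" "v = x' @ wpow w (Suc M) @ y"
    | s where "u = x @ s" "wpow w (Suc M) @ y = s @ v"
    unfolding append_eq_append_conv2[of x] by auto
  then show ?thesis
  proof cases
    case 1
    then have "x' @ wpow w (Suc M') @ y \<in> K'" using K'[of "Suc M" "Suc M'" x' y] uv ge by simp
    then show ?thesis using concI[OF uv(1)] 1 by fastforce
  next
    case 2
    then consider t where "wpow w (Suc M) = s @ t" "v = t @ y"
      | y' where "s = wpow w (Suc M) @ y'" "y = y' @ v"
      unfolding append_eq_append_conv2[of "wpow w (Suc M)"] by auto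
    then show ?thesis
    proof cases
      case (1 t)
      obtain i j p q where c: "i + j = M" "w = p @ q" "s = wpow w i @ p" "t = q @ wpow w j"
        using wpow_cut[OF 1(1)] by blast
      \<comment> \<open>A side with fewer than \<open>n\<close> copies keeps its number, and the
        other side takes the rest of \<open>M'\<close>.\<close>
      have "\<exists>i' j'. i' + j' = M' \<and> (i' = i \<or> i \<ge> n \<and> i' \<ge> n) \<and> (j' = j \<or> j \<ge> n \<and> j' \<ge> n)"
      proof -
        consider "i < n" | "j < n" | "i \<ge> n" "j \<ge> n" by linarith
        then show ?thesis
        proof cases
          case 1
          then show ?thesis using c(1) ge by (intro exI[of _ i] exI[of _ "M' - i"]) auto
        next
          case 2
          then show ?thesis using c(1) ge by (intro exI[of _ "M' - j"] exI[of _ j]) auto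
        next
          case 3
          then show ?thesis using ge by (intro exI[of _ n] exI[of _ "M' - n"]) auto
        qed
      qed
      then obtain i' j' where ij: "i' + j' = M'" "i' = i \<or> i \<ge> n \<and> i' \<ge> n" "j' = j \<or> j \<ge> n \<and> j' \<ge> n"
        by blast
      have "x @ wpow w i' @ p \<in> K" using ij(2) K[of i i' x p] uv(1) 2(1) c(3) by auto
      moreover have "q @ wpow w j' @ y \<in> K'" using ij(3) K'[of j j' q y] uv(2) 1(2) c(4) by auto
      ultimately have "(x @ wpow w i' @ p) @ (q @ wpow w j' @ y) \<in> conc K K'" by (rule concI)
      moreover have "wpow w (Suc M') = wpow w i' @ (p @ q) @ wpow w j'"
        using wpow_add[of i' "Suc j'" w] ij(1) c(2) by simp
      ultimately show ?thesis by simp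
    next
      case (2 y')
      then have "x @ wpow w (Suc M') @ y' \<in> K"
        using K[of "Suc M" "Suc M'" x y'] uv(1) \<open>u = x @ s\<close> ge by simp
      then show ?thesis using concI[OF _ uv(2)] 2 by fastforce
    qed
  qed
qed

lemma stable_conc:
  assumes "stable F n K" "stable F n K'"
  shows "stable F (Suc (2 * n)) (conc K K')"
  unfolding stable_def
proof (intro allI impI)
  fix w i j assume w: "trace F (w @ w) = trace F w" and ij: "i \<ge> Suc (2 * n)" "j \<ge> Suc (2 * n)"
  obtain M M' where M: "i = Suc M" "j = Suc M'" "M \<ge> 2 * n" "M' \<ge> 2 * n"
    using ij by (metis Suc_le_D Suc_le_mono)
  have K: "x @ wpow w i @ y \<in> K \<Longrightarrow> x @ wpow w j @ y \<in> K" if "i \<ge> n" "j \<ge> n" for i j x y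
    using assms(1) w that unfolding stable_def synt_cong_def by blast
  have K': "x @ wpow w i @ y \<in> K' \<Longrightarrow> x @ wpow w j @ y \<in> K'" if "i \<ge> n" "j \<ge> n" for i j x y
    using assms(2) w that unfolding stable_def synt_cong_def by blast
  show "synt_cong (conc K K') (wpow w i) (wpow w j)"
    unfolding synt_cong_def M(1,2)
  proof (intro allI iffI)
    fix x y
    show "x @ wpow w (Suc M) @ y \<in> conc K K' \<Longrightarrow> x @ wpow w (Suc M') @ y \<in> conc K K'"
      by (rule conc_wpow[OF _ _ M(3,4)]) (rule K K'; assumption)+
    show "x @ wpow w (Suc M') @ y \<in> conc K K' \<Longrightarrow> x @ wpow w (Suc M) @ y \<in> conc K K'"
      by (rule conc_wpow[OF _ _ M(4,3)]) (rule K K'; assumption)+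
  qed
qed

lemma SF_stable:
  assumes "prevariety C" "L \<in> SF C"
  shows "\<exists>F n. frame C F \<and> stable F n L"
  using assms(2)
proof (induction rule: SF.induct)
  case (SF_base K)
  then obtain F where F: "frame C F" "K \<in> F" using frame_ex[OF assms(1)] by blast
  \<comment> \<open>Positive powers of \<open>w\<close> share its trace, and membership of a power
    in a context \<open>x\<close>, \<open>y\<close> is membership in a two-sided quotient of
    \<open>K\<close>, which the frame contains.\<close>
  have "stable F 1 K"
    unfolding stable_def
  proof (intro allI impI)
    fix w and i j :: nat assume w: "trace F (w @ w) = trace F w" and ij: "i \<ge> 1" "j \<ge> 1"
    have tr: "trace F (wpow w i) = trace F w" if "i \<ge> 1" for i
      using idempotent_multiple[OF congr_on_trace[OF F(1)], of 1 w i] w that by simp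
    have "x @ wpow w i @ y \<in> K \<longleftrightarrow> x @ wpow w j @ y \<in> K" for x y
    proof -
      have "rquot (lquot x K) y \<in> F" using F unfolding frame_def by blast
      then have "wpow w i \<in> rquot (lquot x K) y \<longleftrightarrow> wpow w j \<in> rquot (lquot x K) y"
        using tr[OF ij(1)] tr[OF ij(2)] trace_eq_iff[of F "wpow w i" "wpow w j"] by simp
      then show ?thesis unfolding rquot_def lquot_def by simp
    qed
    then show "synt_cong K (wpow w i) (wpow w j)" unfolding synt_cong_def by blast
  qed
  then show ?case using F by blast
next
  case (SF_letter a)
  have long: "length (wpow w i) \<ge> i" if "w \<noteq> []" for w :: "'a list" and i
    using that by (induction i) (auto simp: Suc_le_eq less_le_trans trans_le_add2 neq_Nil_conv)
  \<comment> \<open>Powers of a nonempty word with exponent at least 2 are longer than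
    \<open>[a]\<close>, so no context completes them to it; powers of the empty word all
    coincide.\<close>
  have "stable {} 2 {[a]}"
    unfolding stable_def
  proof (intro allI impI)
    fix w :: "'a list" and i j :: nat assume ij: "i \<ge> 2" "j \<ge> 2"
    show "synt_cong {[a]} (wpow w i) (wpow w j)"
    proof (cases "w = []")
      case False
      have "x @ wpow w k @ y \<noteq> [a]" if "k \<ge> 2" for x y k
      proof
        assume "x @ wpow w k @ y = [a]"
        from arg_cong[OF this, of length] show False using long[OF False, of k] that by simp
      qed
      then show ?thesis using ij unfolding synt_cong_def by simp
    qed (simp add: synt_cong_def concat_replicate_trivial)
  qed
  moreover have "frame C {}" unfolding frame_def by simp
  ultimately show ?case by blast
next
  case (SF_union K K')
  then obtain F n G m where F: "frame C F" "stable F n K" "frame C G" "stable G m K'" by blast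
  have "stable (F \<union> G) (max n m) K" "stable (F \<union> G) (max n m) K'"
    using stable_mono[OF F(2), of "F \<union> G" "max n m"] stable_mono[OF F(4), of "F \<union> G" "max n m"] by auto
  then have "stable (F \<union> G) (max n m) (K \<union> K')"
    unfolding stable_def synt_cong_def by blast
  then show ?case using frame_Un[OF F(1,3)] by blast
next
  case (SF_compl K)
  then show ?case unfolding stable_def synt_cong_def by auto
next
  case (SF_conc K K')
  then obtain F n G m where F: "frame C F" "stable F n K" "frame C G" "stable G m K'" by blast
  have "stable (F \<union> G) (max n m) K" "stable (F \<union> G) (max n m) K'"
    using stable_mono[OF F(2), of "F \<union> G" "max n m"] stable_mono[OF F(4), of "F \<union> G" "max n m"] by auto
  then show ?case using stable_conc frame_Un[OF F(1,3)] by blast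
qed

text \<open>Inseparability yields words of equal trace over \<open>e\<close> and \<open>s\<close>.
  From them a word \<open>w\<close> over the orbit element \<open>x\<close> is built whose trace is
  idempotent, and stability applies to \<open>w\<close>.\<close>

lemma stable_orbits_aperiodic:
  assumes "prevariety C" "frame C F" "stable F n L"
  shows "orbits_aperiodic C L"
  unfolding orbits_aperiodic_def
proof (intro ballI impI allI)
  fix e x \<omega>
  assume e: "e \<in> synt_monoid L" "synt_mult L e e = e" and x: "x \<in> C_orbit C L e" and om: "is_omega L \<omega>"
  let ?\<alpha> = "synt_morph L" and ?t = "trace F"
  note ca = congr_onD[OF congr_on_synt_morph[of L]] and ct = congr_onD[OF congr_on_trace[OF assms(2)]]
  obtain s where s: "x = synt_mult L e (synt_mult L s e)" "C_pair C L e s"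
    using x unfolding C_orbit_def by blast
  \<comment> \<open>The trace saturation of the preimage of \<open>e\<close> lies in
    \<open>C\<close>; since it does not separate, it meets the preimage of \<open>s\<close>.\<close>
  define K where "K = {w. ?t w \<in> ?t ` synt_preimage L e}"
  have "K \<in> C" unfolding K_def by (rule trace_saturated_in[OF assms(1,2)])
  moreover have "synt_preimage L e \<subseteq> K" unfolding K_def by blast
  ultimately have "K \<inter> synt_preimage L s \<noteq> {}" using s(2) unfolding C_pair_def separable_def by blast
  then obtain u v where uv: "?\<alpha> u = e" "?\<alpha> v = s" "?t v = ?t u"
    unfolding K_def synt_preimage_def by auto
  have uu: "?\<alpha> (wpow u 1 @ wpow u 1) = ?\<alpha> (wpow u 1)"
    using e(2) synt_mult_morph[of L u u] unfolding uv(1) by (simp add: uv(1))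
  have upow: "?\<alpha> (wpow u k) = ?\<alpha> u" if "k > 0" for k
    using idempotent_multiple[OF congr_on_synt_morph uu that] by simp
  obtain k where k: "k > 0" "?t (wpow u k @ wpow u k) = ?t (wpow u k)"
    using idempotent_power[OF congr_on_trace[OF assms(2)] finite_range_trace[OF assms(2)]] by blast
  obtain l where l: "k = Suc l" using k(1) by (cases k) auto
  \<comment> \<open>Exchanging one \<open>u\<close> of a power for \<open>v\<close> keeps the trace,
    so \<open>w\<close> has the idempotent trace of \<open>wpow u k\<close>. Its image is
    \<open>x\<close> because positive powers of \<open>u\<close> map to \<open>e\<close>;
    \<open>l\<close> may be 0, so it is counted together with \<open>k\<close>.\<close>
  define w where "w = wpow u k @ (wpow u l @ v) @ wpow u k"
  have "?t (wpow u l @ v) = ?t (wpow u l @ u)" by (rule ct[OF refl uv(3)]) simp_all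
  then have "?t (wpow u l @ v) = ?t (wpow u k)" unfolding l wpow_Suc2 .
  then have "?t ((wpow u l @ v) @ wpow u k) = ?t (wpow u k @ wpow u k)" by (rule ct[OF _ refl]) simp_all
  then have "?t ((wpow u l @ v) @ wpow u k) = ?t (wpow u k)" using k(2) by simp
  then have "?t w = ?t (wpow u k @ wpow u k)" unfolding w_def by (rule ct[OF refl]) simp_all
  then have tw: "?t w = ?t (wpow u k)" using k(2) by simp
  have "?t (w @ w) = ?t (wpow u k @ wpow u k)" by (rule ct[OF tw tw]) simp_all
  then have tww: "?t (w @ w) = ?t w" using k(2) tw by simp
  have "?\<alpha> w = ?\<alpha> (wpow u (k + l) @ (v @ wpow u k))" unfolding w_def wpow_add by simp
  also have "\<dots> = ?\<alpha> (u @ (v @ u))"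
    by (intro ca upow refl) (use k(1) in auto)
  also have "\<dots> = x" unfolding s(1) uv(1,2)[symmetric] synt_mult_morph ..
  finally have xw: "x = ?\<alpha> w" ..
  have "\<omega> > 0" and idem: "?\<alpha> (wpow w \<omega> @ wpow w \<omega>) = ?\<alpha> (wpow w \<omega>)"
    using om by (auto simp: is_omega_iff)
  \<comment> \<open>A multiple of \<omega> large enough to pass the threshold
    \<open>n\<close>.\<close>
  define N where "N = \<omega> * Suc n"
  have N: "?\<alpha> (wpow w N) = ?\<alpha> (wpow w \<omega>)"
    unfolding N_def by (rule idempotent_multiple[OF congr_on_synt_morph idem]) simp
  have "n \<le> N" unfolding N_def using \<open>\<omega> > 0\<close> by (cases \<omega>) auto
  then have "?\<alpha> (wpow w (Suc N)) = ?\<alpha> (wpow w N)"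
    using assms(3) tww unfolding stable_def synt_morph_eq_iff by (metis le_SucI)
  moreover have "?\<alpha> (wpow w N @ w) = ?\<alpha> (wpow w \<omega> @ w)" by (rule ca[OF N refl]) simp_all
  ultimately show "synt_pow L x (Suc \<omega>) = synt_pow L x \<omega>"
    unfolding xw synt_pow_morph wpow_Suc2 using N by simp
qed

theorem theorem5p11:
  fixes C :: "('a::finite) list set set" and L :: "'a list set"
  assumes "prevariety C" and "regular L"
  shows "(L \<in> SF C \<longleftrightarrow> L \<in> SD C) \<and> (L \<in> SD C \<longleftrightarrow> orbits_aperiodic C L)"
proof -
  have "L \<in> SD C \<Longrightarrow> L \<in> SF C" by (rule SD_subset_SF[OF assms(1)])
  moreover have "L \<in> SF C \<Longrightarrow> orbits_aperiodic C L"
    using SF_stable[OF assms(1)] stable_orbits_aperiodic[OF assms(1)] by blast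
  moreover have "orbits_aperiodic C L \<Longrightarrow> L \<in> SD C" by (rule orbits_aperiodic_SD[OF assms])
  ultimately show ?thesis by blast
qed

end
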